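(* Write $\tau_\diamond=\tau_\diamond(I^\ast)$ and $\zeta_\diamond=\zeta_\diamond(K^\ast)$. Assume that $0<\tau_\diamond<\infty$ and that there exists $\alpha>0$ such that $$\big\|\Gamma_{2,1}^\ast(\Gamma_{1,1}^\ast)^{+}D f_{I^\ast}\big\|_\circ\le (1-\alpha)\,\tau_\diamond .$$ Define $$M=\frac{\alpha\tau_\diamond}{\|Q\|_{\circ,\mathrm{op}}\left(\|I_{p^2}-Q\|_{\circ,\mathrm{op}}\,c_\diamond+\alpha\tau_\diamond\right)},\qquad r^\ast=1-\frac1{\sqrt{1+M}},\qquad r=\min\{r^\ast,\eta\zeta_\diamond\},$$ $$\delta=\begin{cases}\dfrac{(\sqrt{1+M}-1)^2}{\eta},& \text{if } r^\ast\le\eta\zeta_\diamond,\\[2mm] M\zeta_\diamond-\dfrac{\eta\zeta_\diamond^2}{1-\eta\zeta_\diamond},&\text{if } r^\ast>\eta\zeta_\diamond.\end{cases}$$ Let $\hat K$ be the unique solution of $$\hat K=\arg\min_{K\in\mathrm{Sym}_+(p)}\left\{\mathrm{tr}(\hat\Sigma K)-\log\det(K)+\lambda\,\mathrm{pen}(K)\right\}\quad\text{with}\quad \lambda=\frac{r\,\|I_{p^2}-Q\|_{\circ,\mathrm{op}}}{\eta\,\|Q\|_{\circ,\mathrm{op}}\left(c_\diamond\|I_{p^2}-Q\|_{\circ,\mathrm{op}}+\alpha\tau_\diamond\right)}.$$ If $\|\mathrm{vec}(\hat\Sigma-\Sigma^\ast)\|_\circ<\delta$, then $\mathrm{patt}_\diamond(\hat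 K)=\mathrm{patt}_\diamond(K^\ast)$ and $$\|\Gamma^\ast\mathrm{vec}(\hat K-K^\ast)\|_\circ\le\frac1\eta\left(1-\frac1{\sqrt{1+M}}\right).$$
   Context: Matrices. Let $p\ge 2$, $m=p(p-1)/2$. $\mathrm{Sym}(p)$ is the space of real symmetric $p\times p$ matrices, $\mathrm{Sym}_+(p)$ the positive definite ones, $\mathrm{Sym}_0(p)$ those with zero diagonal. $\mathrm{vec}(X)\in\mathbb R^{p^2}$ stacks the columns of $X$; $\mathrm{vec}_+(X)\in\mathbb R^m$ stacks the strictly lower triangular entries (diagonal excluded). The duplication matrix $D$ is defined by $D\,\mathrm{vec}_+(X)=\mathrm{vec}(X)$ for all $X\in\mathrm{Sym}_0(p)$. $A^+$ is the Moore–Penrose inverse. Atomic norm. $\|x\|_\diamond=\max\{v_1^\top x,\dots,v_N^\top x\}$ on $\mathbb R^m$, where $0$ is in the interior of $\mathrm{conv}\{v_1,\dots,v_N\}$ and no $v_i$ is redundant (for each $i$ there is $x$ with $\max_{j\ne i}v_j^\top x\ne\|x\|_\diamond$). Symmetry $\|-x\|_\diamond=\|x\|_\diamond$ is not required. The dual gauge is $\|y\|_\diamond^\ast=\sup\{x^\top y:\|x\|_\diamond\le1\}$. For $x\in\mathbb R^m$ let $I_x=\{i: v_i^\top x=\|x\|_\diamond\}$; the subdifferential is $\partial\|x\|_\diamond=\mathrm{conv}\{v_i:i\in I_x\}$. We write $\mathrm{patt}_\diamond(x)=\mathrm{patt}_\diamond(y)$ if $\partial\|x\|_\diamond=\partial\|y\|_\diamond$,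 and for $X\in\mathrm{Sym}(p)$ we write $\mathrm{patt}_\diamond(X)$ for $\mathrm{patt}_\diamond(\mathrm{vec}_+(X))$. For $I=I_x$ the pattern subspace is $S_I=\{y\in\mathbb R^m: v_i^\top y=v_j^\top y\ \forall i,j\in I\}$ (the span of $\{y:I_y=I\}$), $P_I$ is the orthogonal projection onto $S_I$, and the face projection is $f_I=P_Iv_{i_0}$ for any $i_0\in I$ (it does not depend on $i_0$). The restricted dual gauge is $\|y\|^\ast_{\diamond|I}=\sup\{x^\top y:x\in S_I,\|x\|_\diamond\le1\}$ for $y\in S_I$. The penalty is $\mathrm{pen}(K)=2\|\mathrm{vec}_+(K)\|_\diamond$. Model. $X$ is a zero-mean random vector in $\mathbb R^p$ with finite second moments and positive definite covariance $\Sigma^\ast$; $K^\ast=(\Sigma^\ast)^{-1}$; $\hat\Sigma=\frac1n\sum_{i=1}^nX^{(i)}(X^{(i)})^\top$ for i.i.d. copies $X^{(i)}$ of $X$. The statement is pointwise, for any realization of $\hat\Sigma$ satisfying the stated inequality. Put $I^\ast=I_{\mathrm{vec}_+(K^\ast)}$, $S^\ast=S_{I^\ast}$, $\mathcal M^\ast=\{K\in\mathrm{Sym}(p):\mathrm{vec}_+(K)\in S^\ast\}$, $\Gamma^\ast=\Sigma^\ast\otimes\Sigma^\ast$, and let $P_{\mathcal M^\ast}\in\mathrm{Sym}(p^2)$ be the orthogonal projection matrix onto $\mathrm{vec}(\mathcal M^\ast)$. Let $\Gamma^\ast_{1,1}=P_{\mathcal M^\ast}\Gamma^\ast P_{\mathcal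 M^\ast}$, $\Gamma^\ast_{2,1}=(I_{p^2}-P_{\mathcal M^\ast})\Gamma^\ast P_{\mathcal M^\ast}$, $Q=\Gamma^\ast(\Gamma^\ast_{1,1})^+$. Norms and constants. $\|\cdot\|_\circ$ is an arbitrary fixed norm on $\mathbb R^{p^2}$ and $\|\cdot\|_{\circ,\mathrm{op}}$ its induced operator norm. $\tau_\diamond(I)=\sup\{t\ge0:\ \forall \pi\in S_I^\perp,\ \|D\pi\|_\circ\le t\Rightarrow\|f_I+\pi\|_\diamond^\ast\le1\}\in[0,\infty]$, which is well defined iff this set is non-empty. $\zeta_\diamond(K^\ast)=\sup\{z>0:\ \forall K\in\mathcal M^\ast,\ \|\Gamma^\ast\mathrm{vec}(K-K^\ast)\|_\circ\le z\Rightarrow\mathrm{patt}_\diamond(K)=\mathrm{patt}_\diamond(K^\ast)\}\in(0,\infty]$. $c_\diamond\ge0$ is a constant with $\|D\pi\|_\circ\le c_\diamond\|\pi\|^\ast_{\diamond|I^\ast}$ for all $\pi\in S^\ast$, and $\eta>0$ is a constant with $\|\Sigma^\ast\Delta\otimes I_p\|_{\circ,\mathrm{op}}\le\eta\,\|\Gamma^\ast\mathrm{vec}(\Delta)\|_\circ$ for all $\Delta\in\mathcal M^\ast$. *)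

theory Defs
  imports "HOL-Probability.Probability"
begin

text \<open>A \<open>p \<times> p\<close> matrix has type \<open>real^'p^'p\<close> with \<open>p = CARD('p)\<close>; the linear order on \<open>'p\<close> gives
  meaning to ``strictly lower triangular''.  Coordinates of \<open>\<real>\<^sup>p\<^sup>2\<close> are indexed by pairs
  \<open>(column, row)\<close>, which, read lexicographically, is the order of column stacking. With this
  convention \<open>vec(A X B) = (B\<^sup>T \<otimes> A) vec(X)\<close>, see \<open>vectorize_mult\<close>.\<close>

type_synonym 'p sqmat = "((real, 'p) vec, 'p) vec"

definition Sym :: "(real^'p^'p) set" where
  "Sym = {A. transpose A = A}"

definition Sym_pos :: "(real^'p^'p) set" where
  "Sym_pos = {A \<in> Sym. \<forall>x. x \<noteq> 0 \<longrightarrow> x \<bullet> (A *v x) > 0}"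

definition Sym_zero :: "(real^'p^'p) set" where
  "Sym_zero = {A \<in> Sym. \<forall>i. A $ i $ i = 0}"

definition vectorize :: "real^'p^'p \<Rightarrow> real^('p \<times> 'p)" where
  "vectorize X = (\<chi> ji. X $ snd ji $ fst ji)"

text \<open>The index type of \<open>\<real>\<^sup>m\<close>, \<open>m = p(p-1)/2\<close>: the positions \<open>(column, row)\<close> with \<open>column < row\<close>.
  The second disjunct only serves to make the type nonempty for \<open>p = 1\<close>.\<close>

typedef (overloaded) ('p :: "{finite,linorder}") lower =
  "{ji :: 'p \<times> 'p. fst ji < snd ji \<or> CARD('p) = 1}"
  morphisms position of_position
proof (cases "CARD('p) = 1")
  case False
  then have "\<not> (\<forall>a b :: 'p. a = b)"
    by (auto simp: card_1_singleton_iff)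
  then obtain a b :: 'p where "a < b"
    by (auto simp: neq_iff)
  then show ?thesis by auto
qed auto

instance lower :: ("{finite,linorder}") finite
proof
  have "inj (position :: 'a lower \<Rightarrow> 'a \<times> 'a)"
    by (meson injI position_inject)
  then show "finite (UNIV :: 'a lower set)"
    using finite_imageD[of position UNIV] by simp
qed

definition vectorize_lower :: "'p::{finite,linorder} sqmat \<Rightarrow> real^('p lower)" where
  "vectorize_lower X = (\<chi> k. X $ snd (position k) $ fst (position k))"

definition duplication :: "real^('p::{finite,linorder} lower)^('p \<times> 'p)" where
  "duplication = (THE D. \<forall>X\<in>Sym_zero. D *v vectorize_lower X = vectorize X)"

definition kronecker :: "real^'b^'a \<Rightarrow> real^'d^'c \<Rightarrow> real^('b \<times> 'd)^('a \<times> 'c)"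
    (infixl \<open>\<otimes>\<^sub>K\<close> 70) where
  "A \<otimes>\<^sub>K B = (\<chi> r c. A $ fst r $ fst c * B $ snd r $ snd c)"

lemma vectorize_mult:
  "vectorize (A ** X ** B) = (transpose B \<otimes>\<^sub>K A) *v vectorize X"
proof -
  have "(\<Sum>k\<in>UNIV. (\<Sum>l\<in>UNIV. A $ i $ l * X $ l $ k) * B $ k $ j)
      = (\<Sum>x\<in>UNIV. B $ fst x $ j * A $ i $ snd x * X $ snd x $ fst x)" for i j
    by (simp add: sum_distrib_right flip: UNIV_Times_UNIV)
       (simp add: sum.cartesian_product case_prod_unfold mult_ac)
  then show ?thesis
    by (simp add: vec_eq_iff vectorize_def matrix_matrix_mult_def matrix_vector_mult_def
        kronecker_def transpose_def)
qed

lemma duplication_unique: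
  assumes "CARD('p::{finite,linorder}) \<ge> 2"
  shows "\<exists>!D :: real^('p lower)^('p \<times> 'p). \<forall>X\<in>Sym_zero. D *v vectorize_lower X = vectorize X"
proof -
  have pos: "fst (position k) < snd (position k)" for k :: "'p lower"
    using position[of k] assms by (auto simp: case_prod_unfold)
  have inv: "position (of_position (j, i)) = (j, i)" if "j < i" for i j :: 'p
    using that by (intro of_position_inverse) auto
  define E :: "real^('p lower)^('p \<times> 'p)" where
    "E = (\<chi> ji k. if position k = ji \<or> position k = (snd ji, fst ji) then 1 else 0)"
  define mk :: "real^('p lower) \<Rightarrow> 'p sqmat" where
    "mk y = (\<chi> i j. if j < i then y $ of_position (j, i)
        else if i < j then y $ of_position (i, j) else 0)" for y
  have mk: "mk y \<in> Sym_zero" "vectorize_lower (mk y) = y" for y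
    using pos by (auto simp: Sym_zero_def Sym_def mk_def vec_eq_iff transpose_def
        vectorize_lower_def position_inverse)
  have E: "E *v vectorize_lower X = vectorize X" if X: "X \<in> Sym_zero" for X
  proof -
    have sym: "X $ i $ j = X $ j $ i" and dg: "X $ i $ i = 0" for i j
      using X by (auto simp: Sym_zero_def Sym_def transpose_def vec_eq_iff)
    have "(\<Sum>k\<in>UNIV. E $ (j, i) $ k * vectorize_lower X $ k) = X $ i $ j" for i j
    proof -
      consider "j < i" | "i < j" | "i = j" by (meson linorder_less_linear)
      then show ?thesis
      proof cases
        case 1
        have "(position k = (j, i) \<or> position k = (i, j)) \<longleftrightarrow> k = of_position (j, i)" for k
        proof -
          have "position k \<noteq> (i, j)" using pos[of k] 1 by auto
          moreover have "position k = (j, i) \<longleftrightarrow> k = of_position (j, i)"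
            using inv[OF 1] position_inject[of k "of_position (j, i)"] by simp
          ultimately show ?thesis by blast
        qed
        then have "(\<Sum>k\<in>UNIV. E $ (j, i) $ k * vectorize_lower X $ k)
            = (\<Sum>k\<in>UNIV. if k = of_position (j, i) then vectorize_lower X $ k else 0)"
          unfolding E_def by (intro sum.cong refl) simp
        then show ?thesis by (simp add: vectorize_lower_def inv[OF 1])
      next
        case 2
        have "(position k = (j, i) \<or> position k = (i, j)) \<longleftrightarrow> k = of_position (i, j)" for k
        proof -
          have "position k \<noteq> (j, i)" using pos[of k] 2 by auto
          moreover have "position k = (i, j) \<longleftrightarrow> k = of_position (i, j)"
            using inv[OF 2] position_inject[of k "of_position (i, j)"] by simp
          ultimately show ?thesis by blast
        qed
        then have "(\<Sum>k\<in>UNIV. E $ (j, i) $ k * vectorize_lower X $ k)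
            = (\<Sum>k\<in>UNIV. if k = of_position (i, j) then vectorize_lower X $ k else 0)"
          unfolding E_def by (intro sum.cong refl) simp
        then show ?thesis by (simp add: vectorize_lower_def inv[OF 2] sym[of i j])
      next
        case 3
        have "E $ (j, i) $ k = 0" for k
          using pos[of k] 3 by (auto simp: E_def)
        then show ?thesis by (simp add: 3 dg)
      qed
    qed
    then show ?thesis
      by (auto simp: vec_eq_iff matrix_vector_mult_def vectorize_def)
  qed
  show ?thesis
  proof (rule ex1I[of _ E])
    show "\<forall>X\<in>Sym_zero. E *v vectorize_lower X = vectorize X" using E by blast
    fix D :: "real^('p lower)^('p \<times> 'p)"
    assume "\<forall>X\<in>Sym_zero. D *v vectorize_lower X = vectorize X"
    then have "D *v y = E *v y" for y using mk E by metis
    then show "D = E" by (simp add: matrix_eq)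
  qed
qed

definition orth_proj :: "'a::euclidean_space set \<Rightarrow> 'a \<Rightarrow> 'a" where
  "orth_proj S x = (THE y. y \<in> S \<and> x - y \<in> S\<^sup>\<bottom>)"

lemma orth_proj_unique:
  fixes S :: "'a::euclidean_space set"
  assumes "subspace S"
  shows "\<exists>!y. y \<in> S \<and> x - y \<in> S\<^sup>\<bottom>"
proof -
  obtain y z where yz: "y \<in> span S" "\<And>w. w \<in> span S \<Longrightarrow> orthogonal z w" "x = y + z"
    using orthogonal_subspace_decomp_exists[of S x] by blast
  have "y \<in> S" using yz(1) assms by (metis span_eq_iff)
  moreover have "x - y \<in> S\<^sup>\<bottom>"
    using yz(2,3) by (auto simp: orthogonal_comp_def orthogonal_commute span_base)
  moreover have "y1 = y2"
    if "y1 \<in> S" "x - y1 \<in> S\<^sup>\<bottom>" "y2 \<in> S" "x - y2 \<in> S\<^sup>\<bottom>" for y1 y2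
  proof -
    have "y1 - y2 \<in> S" using that assms by (simp add: subspace_diff)
    moreover have "y1 - y2 \<in> S\<^sup>\<bottom>"
      using subspace_diff[OF subspace_orthogonal_comp that(4,2)] by simp
    ultimately have "orthogonal (y1 - y2) (y1 - y2)" by (simp add: orthogonal_comp_def)
    then show ?thesis by (simp add: orthogonal_def)
  qed
  ultimately show ?thesis by blast
qed

definition moore_penrose :: "real^'n^'m \<Rightarrow> real^'m^'n" where
  "moore_penrose A = (THE B. A ** B ** A = A \<and> B ** A ** B = B \<and>
     transpose (A ** B) = A ** B \<and> transpose (B ** A) = B ** A)"

definition is_norm :: "('a::real_vector \<Rightarrow> real) \<Rightarrow> bool" where
  "is_norm N \<longleftrightarrow> (\<forall>x. N x \<ge> 0) \<and> (\<forall>x. N x = 0 \<longleftrightarrow> x = 0) \<and>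
     (\<forall>c x. N (c *\<^sub>R x) = \<bar>c\<bar> * N x) \<and> (\<forall>x y. N (x + y) \<le> N x + N y)"

text \<open>The same formula as \<^const>\<open>onorm\<close>, for a norm other than the one of the type class.\<close>

definition op_norm :: "(real^'n \<Rightarrow> real) \<Rightarrow> real^'n^'n \<Rightarrow> real" where
  "op_norm N A = (SUP x. N (A *v x) / N x)"

text \<open>The atoms \<open>v\<^sub>1, \<dots>, v\<^sub>N\<close> are a family indexed by a finite type \<open>'n\<close>, \<open>N = CARD('n)\<close>.\<close>

definition atomic_norm :: "('n::finite \<Rightarrow> 'a::euclidean_space) \<Rightarrow> 'a \<Rightarrow> real" where
  "atomic_norm v x = Max ((\<lambda>i. v i \<bullet> x) ` UNIV)"

definition admissible_atoms :: "('n::finite \<Rightarrow> 'a::euclidean_space) \<Rightarrow> bool" where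
  "admissible_atoms v \<longleftrightarrow> 0 \<in> interior (convex hull range v) \<and>
     (\<forall>i. \<exists>x. Max ((\<lambda>j. v j \<bullet> x) ` (UNIV - {i})) \<noteq> atomic_norm v x)"

definition dual_gauge :: "('n::finite \<Rightarrow> 'a::euclidean_space) \<Rightarrow> 'a \<Rightarrow> real" where
  "dual_gauge v y = Sup {x \<bullet> y | x. atomic_norm v x \<le> 1}"

definition active :: "('n::finite \<Rightarrow> 'a::euclidean_space) \<Rightarrow> 'a \<Rightarrow> 'n set" where
  "active v x = {i. v i \<bullet> x = atomic_norm v x}"

definition subdiff :: "('n::finite \<Rightarrow> 'a::euclidean_space) \<Rightarrow> 'a \<Rightarrow> 'a set" where
  "subdiff v x = convex hull (v ` active v x)"

text \<open>Patterns are only ever compared for equality, and \<open>x\<close> and \<open>y\<close> have the same pattern iff their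
  subdifferentials agree.\<close>

definition same_patt :: "('n::finite \<Rightarrow> 'a::euclidean_space) \<Rightarrow> 'a \<Rightarrow> 'a \<Rightarrow> bool" where
  "same_patt v x y \<longleftrightarrow> subdiff v x = subdiff v y"

definition same_patt_mat ::
    "('n::finite \<Rightarrow> real^('p::{finite,linorder} lower)) \<Rightarrow> 'p sqmat \<Rightarrow> 'p sqmat \<Rightarrow> bool" where
  "same_patt_mat v X Y \<longleftrightarrow> same_patt v (vectorize_lower X) (vectorize_lower Y)"

definition patt_space :: "('n::finite \<Rightarrow> 'a::euclidean_space) \<Rightarrow> 'n set \<Rightarrow> 'a set" where
  "patt_space v I = {y. \<forall>i\<in>I. \<forall>j\<in>I. v i \<bullet> y = v j \<bullet> y}"

text \<open>The choice of \<open>i \<in> I\<close> is immaterial, see \<open>face_proj_eq\<close>.\<close>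

definition face_proj :: "('n::finite \<Rightarrow> 'a::euclidean_space) \<Rightarrow> 'n set \<Rightarrow> 'a" where
  "face_proj v I = orth_proj (patt_space v I) (v (SOME i. i \<in> I))"

lemma subspace_patt_space: "subspace (patt_space v I)"
  unfolding subspace_def patt_space_def
proof (intro conjI ballI allI CollectI)
  fix x y i j
  assume xy: "x \<in> {y. \<forall>i\<in>I. \<forall>j\<in>I. v i \<bullet> y = v j \<bullet> y}" "y \<in> {y. \<forall>i\<in>I. \<forall>j\<in>I. v i \<bullet> y = v j \<bullet> y}"
    and ij: "i \<in> I" "j \<in> I"
  have "v i \<bullet> x = v j \<bullet> x" "v i \<bullet> y = v j \<bullet> y" using xy ij by blast+
  then show "v i \<bullet> (x + y) = v j \<bullet> (x + y)" by (simp add: inner_add_right)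
next
  fix c x i j
  assume x: "x \<in> {y. \<forall>i\<in>I. \<forall>j\<in>I. v i \<bullet> y = v j \<bullet> y}" and ij: "i \<in> I" "j \<in> I"
  have "v i \<bullet> x = v j \<bullet> x" using x ij by blast
  then show "v i \<bullet> (c *\<^sub>R x) = v j \<bullet> (c *\<^sub>R x)" by simp
qed simp

lemma face_proj_eq:
  assumes "i \<in> I"
  shows "face_proj v I = orth_proj (patt_space v I) (v i)"
proof -
  define k where "k = (SOME i. i \<in> I)"
  have k: "k \<in> I" using assms unfolding k_def by (rule someI)
  let ?S = "patt_space v I"
  have d: "v k - v i \<in> ?S\<^sup>\<bottom>"
    unfolding orthogonal_comp_def orthogonal_def
  proof (intro CollectI ballI)
    fix y assume "y \<in> ?S"
    then have "v k \<bullet> y = v i \<bullet> y" using k assms unfolding patt_space_def by blast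
    then show "y \<bullet> (v k - v i) = 0" by (simp add: inner_diff_right inner_commute[of y])
  qed
  have "v k - y \<in> ?S\<^sup>\<bottom> \<longleftrightarrow> v i - y \<in> ?S\<^sup>\<bottom>" for y
    using subspace_add[OF subspace_orthogonal_comp d, of "v i - y"]
      subspace_diff[OF subspace_orthogonal_comp _ d, of "v k - y"] by auto
  then show ?thesis by (simp add: face_proj_def orth_proj_def k_def)
qed

definition restricted_dual_gauge ::
    "('n::finite \<Rightarrow> 'a::euclidean_space) \<Rightarrow> 'n set \<Rightarrow> 'a \<Rightarrow> real" where
  "restricted_dual_gauge v I y = Sup {x \<bullet> y | x. x \<in> patt_space v I \<and> atomic_norm v x \<le> 1}"

definition pen ::
    "('n::finite \<Rightarrow> real^('p::{finite,linorder} lower)) \<Rightarrow> 'p sqmat \<Rightarrow> real" where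
  "pen v K = 2 * atomic_norm v (vectorize_lower K)"

definition model_space ::
    "('n::finite \<Rightarrow> real^('p::{finite,linorder} lower)) \<Rightarrow> 'p sqmat \<Rightarrow> ('p sqmat) set" where
  "model_space v Ks =
     {K \<in> Sym. vectorize_lower K \<in> patt_space v (active v (vectorize_lower Ks))}"

text \<open>\<open>\<zeta>(K\<^sup>*)\<close> takes \<open>\<Sigma>\<^sup>* = (K\<^sup>*)\<^sup>-\<^sup>1\<close> as its argument. Both suprema are taken in the extended reals. The supremum of the empty set is \<open>-\<infinity>\<close>, so
  \<open>tau v N I \<ge> 0\<close> says exactly that \<open>\<tau>(I)\<close> is well defined.\<close>

definition tau ::
    "('n::finite \<Rightarrow> real^('p::{finite,linorder} lower)) \<Rightarrow> (real^('p \<times> 'p) \<Rightarrow> real) \<Rightarrow>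
     'n set \<Rightarrow> ereal" where
  "tau v N I = Sup (ereal ` {t. t \<ge> 0 \<and> (\<forall>\<pi> \<in> (patt_space v I)\<^sup>\<bottom>.
     N (duplication *v \<pi>) \<le> t \<longrightarrow> dual_gauge v (face_proj v I + \<pi>) \<le> 1)})"

definition zeta ::
    "('n::finite \<Rightarrow> real^('p::{finite,linorder} lower)) \<Rightarrow> (real^('p \<times> 'p) \<Rightarrow> real) \<Rightarrow>
     'p sqmat \<Rightarrow> ereal" where
  "zeta v N \<Sigma> = (let Ks = matrix_inv \<Sigma> in
     Sup (ereal ` {z. z > 0 \<and> (\<forall>K \<in> model_space v Ks.
       N ((\<Sigma> \<otimes>\<^sub>K \<Sigma>) *v vectorize (K - Ks)) \<le> z \<longrightarrow> same_patt_mat v K Ks)}))"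

definition cov_matrix :: "'w measure \<Rightarrow> ('w \<Rightarrow> real^'p) \<Rightarrow> 'p sqmat" where
  "cov_matrix P X = (\<chi> i j. integral\<^sup>L P (\<lambda>w. (X w $ i - integral\<^sup>L P (\<lambda>w. X w $ i)) *
     (X w $ j - integral\<^sup>L P (\<lambda>w. X w $ j))))"

definition iid_copies ::
    "'w measure \<Rightarrow> nat set \<Rightarrow> (nat \<Rightarrow> 'w \<Rightarrow> real^'p) \<Rightarrow> ('w \<Rightarrow> real^'p) \<Rightarrow> bool" where
  "iid_copies P J Xs X \<longleftrightarrow> prob_space.indep_vars P (\<lambda>_. borel) Xs J \<and>
     (\<forall>k\<in>J. Xs k \<in> borel_measurable P \<and> distr P borel (Xs k) = distr P borel X)"

definition sample_cov :: "nat \<Rightarrow> (nat \<Rightarrow> real^'p) \<Rightarrow> 'p sqmat" where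
  "sample_cov n x = (1 / real n) *\<^sub>R (\<Sum>k=1..n. (\<chi> i j. x k $ i * x k $ j))"

definition glasso_objective ::
    "('n::finite \<Rightarrow> real^('p::{finite,linorder} lower)) \<Rightarrow> real \<Rightarrow> 'p sqmat \<Rightarrow> 'p sqmat \<Rightarrow> real"
  where
  "glasso_objective v l S K = trace (S ** K) - ln (det K) + l * pen v K"

end

theory Submission
  imports Defs
begin

text \<open>
  The proof is a primal-dual witness argument.  On the matrices with the pattern of \<open>K\<^sup>*\<close> the penalty
  is linear, \<open>pen(K) = \<langle>D f, vec K\<rangle>\<close> with \<open>f\<close> the face projection.  For the problem with this
  linear penalty on \<open>\<M>\<^sup>*\<close>, the stationarity equation at \<open>K = K\<^sup>* + \<Delta>\<close> says that
  \<open>vec(K\<^sup>-\<^sup>1 - \<Sigma>hat) - \<lambda> D f\<close> is orthogonal to \<open>vec \<M>\<^sup>*\<close>.  Writing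
  \<open>(K\<^sup>* + \<Delta>)\<^sup>-\<^sup>1 = \<Sigma> - \<Sigma>\<Delta>\<Sigma> + R(\<Delta>)\<close> turns it into the fixed point equation
  \<open>vec \<Delta> = \<Gamma>\<^sub>1\<^sub>1\<^sup>+ (vec(\<Sigma> - \<Sigma>hat) + vec R(\<Delta>) - \<lambda> D f)\<close>.
  The remainder is quadratic: if \<open>\<eta>\<parallel>\<Gamma> vec \<Delta>\<parallel> \<le> r < 1\<close>, its norm is at most
  \<open>r\<^sup>2 / (\<eta>(1 - r))\<close> (\<open>inverse_remainder_bound\<close>).  The constants are such that
  \<open>\<delta> = rM/\<eta> - r\<^sup>2 / (\<eta>(1 - r))\<close>; the radius \<open>1 - 1/sqrt(1+M)\<close> is where this function of
  \<open>r\<close> peaks.  Hence the right-hand side maps the convex body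
  \<open>{\<Delta> \<in> \<M>\<^sup>*. \<parallel>\<Gamma> vec \<Delta>\<parallel> \<le> r/\<eta>}\<close> into the corresponding open ball, and Brouwer's theorem
  gives a fixed point (\<open>restricted_stationary_point_exists\<close>).  Since \<open>r/\<eta> \<le> \<zeta>\<close>, the
  matrix \<open>K\<close> obtained in this way has the pattern of \<open>K\<^sup>*\<close>.

  It remains to see that \<open>K\<close> solves the unrestricted problem.  The residual of the stationarity
  equation is \<open>(1 - Q)(vec(\<Sigma> - \<Sigma>hat) + vec R(\<Delta>)) - \<lambda>(1 - Q) D f\<close>.  It is orthogonal to
  \<open>vec \<M>\<^sup>*\<close>, which contains the diagonal matrices, so it equals \<open>\<lambda> D \<pi>\<close> for some
  \<open>\<pi>\<close> orthogonal to the pattern subspace.  Moreover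
  \<open>\<Gamma>\<^sub>2\<^sub>1 \<Gamma>\<^sub>1\<^sub>1\<^sup>+ D f = -(1 - Q) D f\<close>, and so the irrepresentability condition, the deviation
  bound and the choice of \<open>\<lambda>\<close> give \<open>\<parallel>D \<pi>\<parallel> < \<tau>\<close>.  By definition of \<open>\<tau>\<close>, the dual gauge of
  \<open>f + \<pi>\<close> is at most 1, which makes \<open>f + \<pi>\<close> a subgradient of the atomic norm at \<open>vec\<^sub>+(K)\<close>.
  The matrix \<open>K\<close> thus satisfies the first order condition, which characterises the unique minimiser
  because \<open>-ln det\<close> is strictly convex (\<open>glasso_unique_minimizer\<close>).

  Both the strict convexity and the positive definiteness of \<open>K\<^sup>* + \<Delta>\<close> come from the
  simultaneous diagonalisation of a positive definite and a symmetric form.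
\<close>

section \<open>Simultaneous diagonalisation\<close>

lemma matrix_add_rdistrib: "(A + B) ** C = A ** C + B ** C"
  for A B :: "'a::semiring_1^'n^'m"
  by (vector matrix_matrix_mult_def sum.distrib[symmetric] field_simps)

lemma matrix_diff_rdistrib: "(A - B) ** C = A ** C - B ** C"
  for A B :: "'a::ring_1^'n^'m"
  by (vector matrix_matrix_mult_def sum_subtractf[symmetric] field_simps)

lemma matrix_diff_ldistrib: "A ** (B - C) = A ** B - A ** C"
  for B C :: "'a::ring_1^'n^'m"
  by (vector matrix_matrix_mult_def sum_subtractf[symmetric] field_simps)

lemma inner_matrix_vector_transpose: "x \<bullet> (A *v y) = (transpose A *v x) \<bullet> y"
  for A :: "real^'n^'m"
  by (metis dot_lmul_matrix transpose_matrix_vector)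

lemma matrix_inv_unique:
  fixes A B :: "real^'n^'n"
  assumes "A ** B = mat 1"
  shows "matrix_inv A = B"
proof -
  have BA: "B ** A = mat 1" using assms by (simp add: matrix_left_right_inverse)
  have "A ** matrix_inv A = mat 1 \<and> matrix_inv A ** A = mat 1"
    unfolding matrix_inv_def by (rule someI[of _ B]) (simp add: assms BA)
  then show ?thesis
    by (metis BA matrix_mul_assoc matrix_mul_lid matrix_mul_rid)
qed

lemma matrix_inv_mult:
  fixes A :: "real^'n^'n"
  assumes "invertible A"
  shows "A ** matrix_inv A = mat 1" "matrix_inv A ** A = mat 1"
  using assms matrix_inv_unique[of A] matrix_left_right_inverse by (metis invertible_right_inverse)+

lemma transpose_add: "transpose (A + B) = transpose A + transpose B"
  and transpose_diff: "transpose (A - B) = transpose A - transpose B"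
  for A B :: "real^'n^'m"
  by (vector transpose_def)+

lemma subspace_Sym: "subspace Sym"
  by (auto simp: subspace_def Sym_def transpose_add transpose_scalar)
     (vector transpose_def)

lemma Sym_pos_kernel: "A \<in> Sym_pos \<Longrightarrow> A *v x = 0 \<Longrightarrow> x = 0"
  by (force simp: Sym_pos_def)

lemma Sym_pos_invertible:
  assumes "A \<in> Sym_pos"
  shows "invertible A"
  using Sym_pos_kernel[OF assms] by (metis invertible_left_inverse matrix_left_invertible_ker)

lemma orthogonal_if_form_nonneg:
  fixes B :: "real^'n^'n"
  assumes B: "transpose B = B" and x: "x \<bullet> (B *v x) = 0"
    and nonneg: "\<And>t. (x + t *\<^sub>R y) \<bullet> (B *v (x + t *\<^sub>R y)) \<ge> 0"
  shows "y \<bullet> (B *v x) = 0"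
proof (rule ccontr)
  let ?b = "y \<bullet> (B *v x)" and ?c = "y \<bullet> (B *v y)"
  assume b: "?b \<noteq> 0"
  have sym: "x \<bullet> (B *v y) = ?b"
    by (metis B inner_commute inner_matrix_vector_transpose)
  have q: "0 \<le> 2 * t * ?b + t\<^sup>2 * ?c" for t
    using nonneg[of t] x sym
    by (simp add: matrix_vector_right_distrib matrix_vector_mult_scaleR inner_add_left inner_add_right power2_eq_square
        algebra_simps)
  \<comment> \<open>the parabola is negative at this point, close enough to its zero at the origin\<close>
  define a where "a = \<bar>?c\<bar> + 1"
  define t where "t = - ?b / a"
  have a: "a > 0" by (simp add: a_def)
  have "2 * t * ?b + t\<^sup>2 * ?c \<le> 2 * t * ?b + t\<^sup>2 * a"
    by (intro add_left_mono mult_left_mono) (auto simp: a_def)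
  also have "\<dots> = - (?b\<^sup>2 / a)"
    unfolding t_def using a by (simp add: power2_eq_square field_simps)
  also have "\<dots> < 0" using b a by simp
  finally show False using q[of t] by simp
qed

text \<open>Adding an index to \<open>J\<close>: the Rayleigh quotient \<open>x\<^sup>T L x / x\<^sup>T K x\<close> attains its maximum \<open>m\<close> on
  the \<open>K\<close>-orthogonal complement of the eigenvectors found so far.  At a maximiser the form
  \<open>m K - L\<close> is nonnegative on the complement and vanishes, so \<open>(m K - L) x\<close> is orthogonal to the
  complement; it is orthogonal to the earlier eigenvectors as well and hence zero.\<close>

lemma generalized_eigenvectors_exist:
  fixes K L :: "real^'n^'n" and J :: "'n set"
  assumes K: "K \<in> Sym_pos" and L: "L \<in> Sym"
  shows "\<exists>z d. \<forall>i\<in>J. L *v z i = d i *\<^sub>R (K *v z i) \<and>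
           (\<forall>j\<in>J. z i \<bullet> (K *v z j) = (if i = j then 1 else 0))"
proof (induction J rule: finite_induct[OF finite])
  case 1
  then show ?case by simp
next
  case (2 k J)
  have symK: "transpose K = K" and symL: "transpose L = L"
    using K L by (auto simp: Sym_pos_def Sym_def)
  have Ksw: "x \<bullet> (K *v y) = y \<bullet> (K *v x)" for x y
    by (metis symK inner_commute inner_matrix_vector_transpose)
  have Lsw: "x \<bullet> (L *v y) = y \<bullet> (L *v x)" for x y
    by (metis symL inner_commute inner_matrix_vector_transpose)
  obtain z d where z: "\<And>i. i \<in> J \<Longrightarrow> L *v z i = d i *\<^sub>R (K *v z i)"
    "\<And>i j. i \<in> J \<Longrightarrow> j \<in> J \<Longrightarrow> z i \<bullet> (K *v z j) = (if i = j then 1 else 0)"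
    using 2(3) by blast
  define S where "S = {x. \<forall>j\<in>J. x \<bullet> (K *v z j) = 0}"
  have subS: "subspace S"
    by (auto simp: S_def subspace_def inner_add_left)
  have "dim ((\<lambda>j. K *v z j) ` J) \<le> card J"
    using dim_le_card'[of "(\<lambda>j. K *v z j) ` J"] card_image_le 2(1) le_trans
    by blast
  also have "\<dots> < CARD('n)"
    using 2(1,2) card_mono[of UNIV "insert k J"] by simp
  finally have "dim ((\<lambda>j. K *v z j) ` J) < DIM(real^'n)" by simp
  then obtain x0 where x0: "x0 \<noteq> 0" "\<And>y. y \<in> span ((\<lambda>j. K *v z j) ` J) \<Longrightarrow> orthogonal x0 y"
    using orthogonal_to_subspace_exists by blast
  then have x0S: "x0 \<in> S" by (auto simp: S_def orthogonal_def span_base)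
  define C where "C = S \<inter> sphere 0 1"
  have "compact C"
    unfolding C_def using closed_subspace[OF subS] by (simp add: closed_Int_compact)
  moreover have "x0 /\<^sub>R norm x0 \<in> C"
    using x0S x0(1) subS by (auto simp: C_def subspace_scale)
  moreover have "continuous_on C (\<lambda>x. (x \<bullet> (L *v x)) / (x \<bullet> (K *v x)))"
  proof (intro continuous_intros linear_continuous_on[OF matrix_vector_mul_bounded_linear] ballI)
    fix x assume "x \<in> C"
    then have "x \<noteq> 0" by (auto simp: C_def)
    then show "x \<bullet> (K *v x) \<noteq> 0" using K by (force simp: Sym_pos_def)
  qed
  ultimately obtain x where x: "x \<in> C"
    "\<And>y. y \<in> C \<Longrightarrow> (y \<bullet> (L *v y)) / (y \<bullet> (K *v y)) \<le> (x \<bullet> (L *v x)) / (x \<bullet> (K *v x))"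
    using continuous_attains_sup[of C] by blast
  define m where "m = (x \<bullet> (L *v x)) / (x \<bullet> (K *v x))"
  define B where "B = m *\<^sub>R K - L"
  have xn: "x \<noteq> 0" and xS: "x \<in> S" using x(1) by (auto simp: C_def)
  have Kp: "y \<bullet> (K *v y) > 0" if "y \<noteq> 0" for y using K that by (simp add: Sym_pos_def)
  have Bv: "B *v y = m *\<^sub>R (K *v y) - L *v y" for y
    by (simp add: B_def matrix_vector_mult_diff_rdistrib scaleR_matrix_vector_assoc)
  have Bpos: "y \<bullet> (B *v y) \<ge> 0" if "y \<in> S" for y
  proof (cases "y = 0")
    case False
    have "y /\<^sub>R norm y \<in> C" using that False subS by (auto simp: C_def subspace_scale)
    from x(2)[OF this] have "(y \<bullet> (L *v y)) / (y \<bullet> (K *v y)) \<le> m"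
      using False by (simp add: m_def matrix_vector_mult_scaleR field_simps)
    then show ?thesis using Kp[OF False] by (simp add: Bv inner_diff_right field_simps)
  qed simp
  have Bx0: "y \<bullet> (B *v x) = 0" if "y \<in> S" for y
  proof (rule orthogonal_if_form_nonneg)
    show "transpose B = B" by (simp add: B_def transpose_diff transpose_scalar symK symL)
    show "x \<bullet> (B *v x) = 0" using Kp[OF xn] by (simp add: Bv inner_diff_right m_def)
    show "(x + t *\<^sub>R y) \<bullet> (B *v (x + t *\<^sub>R y)) \<ge> 0" for t
      using that xS subS by (intro Bpos) (simp add: subspace_add subspace_scale)
  qed
  have Bxz: "z j \<bullet> (B *v x) = 0" if "j \<in> J" for j
  proof -
    have "z j \<bullet> (K *v x) = 0" using xS that by (simp add: S_def Ksw[of "z j"])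
    moreover have "z j \<bullet> (L *v x) = 0"
      using xS that z(1) by (simp add: S_def Lsw[of "z j"])
    ultimately show ?thesis by (simp add: Bv inner_diff_right)
  qed
  have "y \<bullet> (B *v x) = 0" for y
  proof -
    define w where "w = (\<Sum>j\<in>J. (y \<bullet> (K *v z j)) *\<^sub>R z j)"
    have "w \<bullet> (K *v z i) = y \<bullet> (K *v z i)" if "i \<in> J" for i
    proof -
      have "w \<bullet> (K *v z i) = (\<Sum>j\<in>J. if j = i then y \<bullet> (K *v z j) else 0)"
        unfolding w_def inner_sum_left by (rule sum.cong) (auto simp: z(2) that)
      then show ?thesis using that 2(1) by simp
    qed
    then have "y - w \<in> S" by (simp add: S_def inner_diff_left)
    moreover have "w \<bullet> (B *v x) = 0" by (simp add: w_def inner_sum_left Bxz)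
    ultimately show ?thesis using Bx0[of "y - w"] by (simp add: inner_diff_left)
  qed
  then have "B *v x = 0" using inner_eq_zero_iff by blast
  then have Lx: "L *v x = m *\<^sub>R (K *v x)" by (simp add: Bv)
  define s where "s = 1 / sqrt (x \<bullet> (K *v x))"
  have s: "s * s * (x \<bullet> (K *v x)) = 1"
    using Kp[OF xn] by (simp add: s_def real_sqrt_mult_self)
  define z' where "z' = z(k := s *\<^sub>R x)"
  define d' where "d' = d(k := m)"
  have old: "z' j = z j" "d' j = d j" if "j \<in> J" for j
    using that 2(2) by (auto simp: z'_def d'_def)
  have new: "z' k = s *\<^sub>R x" "d' k = m" by (simp_all add: z'_def d'_def)
  have "L *v z' i = d' i *\<^sub>R (K *v z' i)" if "i \<in> insert k J" for i
  proof (cases "i = k")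
    case True
    then show ?thesis by (simp add: new Lx matrix_vector_mult_scaleR)
  next
    case False
    then show ?thesis using that by (simp add: old z(1))
  qed
  moreover have "z' i \<bullet> (K *v z' j) = (if i = j then 1 else 0)"
    if ij: "i \<in> insert k J" "j \<in> insert k J" for i j
  proof -
    have 0: "x \<bullet> (K *v z l) = 0" "z l \<bullet> (K *v x) = 0" if "l \<in> J" for l
      using xS that Ksw[of "z l" x] by (simp_all add: S_def)
    consider "i = k" "j = k" | "i = k" "j \<noteq> k" "j \<in> J" | "i \<noteq> k" "j = k" "i \<in> J"
      | "i \<in> J" "j \<in> J" using ij by blast
    then show ?thesis
    proof cases
      case 1
      then show ?thesis using s by (simp add: new matrix_vector_mult_scaleR)
    next
      case 2
      then show ?thesis by (simp add: new old matrix_vector_mult_scaleR 0)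
    next
      case 3
      then show ?thesis by (simp add: new old matrix_vector_mult_scaleR 0)
    next
      case 4
      then show ?thesis by (simp add: old z(2))
    qed
  qed
  ultimately have "\<forall>i\<in>insert k J. L *v z' i = d' i *\<^sub>R (K *v z' i) \<and>
           (\<forall>j\<in>insert k J. z' i \<bullet> (K *v z' j) = (if i = j then 1 else 0))"
    by (intro ballI conjI)
  then show ?case by (rule exI[of _ z', OF exI[of _ d']])
qed

lemma simultaneous_diagonalization:
  fixes K L :: "real^'n^'n"
  assumes "K \<in> Sym_pos" and "L \<in> Sym"
  obtains Z :: "real^'n^'n" and d where "transpose Z ** K ** Z = mat 1"
    "transpose Z ** L ** Z = (\<chi> i j. if i = j then d i else 0)"
    "invertible Z"
proof -
  obtain z :: "'n \<Rightarrow> real^'n" and d where z: "\<And>i. L *v z i = d i *\<^sub>R (K *v z i)"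
    "\<And>i j. z i \<bullet> (K *v z j) = (if i = j then 1 else 0)"
    using generalized_eigenvectors_exist[OF assms, of UNIV] by auto
  define Z where "Z = (\<chi> i j. z j $ i)"
  have entry: "(transpose Z ** A ** Z) $ i $ j = z i \<bullet> (A *v z j)" for A i j
    unfolding matrix_mul_assoc[symmetric]
    by (simp add: matrix_matrix_mult_def transpose_def Z_def inner_vec_def matrix_vector_mult_def)
  have one: "transpose Z ** K ** Z = mat 1"
    by (simp add: vec_eq_iff entry z mat_def)
  moreover have "transpose Z ** L ** Z = (\<chi> i j. if i = j then d i else 0)"
    by (simp add: vec_eq_iff entry z)
  moreover have "invertible Z"
    using one by (auto simp: invertible_left_inverse)
  ultimately show ?thesis by (rule that)
qed

section \<open>The log-determinant and the continuity of the inverse\<close>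

lemma inner_matrix_eq_sum: "A \<bullet> B = (\<Sum>i\<in>UNIV. \<Sum>j\<in>UNIV. A $ i $ j * B $ i $ j)"
  for A B :: "real^'n^'m"
  by (simp add: inner_vec_def)

lemma trace_Sym_mult: "A \<in> Sym \<Longrightarrow> trace (A ** B) = A \<bullet> B"
proof -
  assume "A \<in> Sym"
  then have "A $ i $ j = A $ j $ i" for i j by (auto simp: Sym_def transpose_def vec_eq_iff)
  then have "trace (A ** B) = (\<Sum>i\<in>UNIV. \<Sum>j\<in>UNIV. A $ j $ i * B $ j $ i)"
    by (simp add: trace_def matrix_matrix_mult_def)
  also have "\<dots> = A \<bullet> B" unfolding inner_matrix_eq_sum by (rule sum.swap)
  finally show ?thesis .
qed

lemma Sym_matrix_inv:
  fixes A :: "real^'n^'n"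
  assumes "A \<in> Sym" "invertible A"
  shows "matrix_inv A \<in> Sym"
proof -
  have "transpose (matrix_inv A) ** A = transpose (A ** matrix_inv A)"
    using assms(1) by (simp add: matrix_transpose_mul Sym_def)
  then have "transpose (matrix_inv A) ** A = mat 1"
    by (simp add: matrix_inv_mult[OF assms(2)])
  then have "A ** transpose (matrix_inv A) = mat 1" by (simp add: matrix_left_right_inverse)
  then have "transpose (matrix_inv A) = matrix_inv A" by (rule matrix_inv_unique[symmetric])
  then show ?thesis by (simp add: Sym_def)
qed

lemma form_positive_diagonal:
  fixes A Z :: "real^'n^'n"
  assumes A: "A \<in> Sym_pos" and Z: "invertible Z"
    and diag: "transpose Z ** A ** Z = (\<chi> i j. if i = j then d i else 0)"
  shows "d i > 0"
proof -
  let ?z = "Z *v axis i 1"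
  have "axis i (1::real) \<noteq> 0" by (simp add: axis_eq_0_iff)
  then have "?z \<noteq> 0"
    using Z by (metis invertible_left_inverse matrix_left_invertible_ker)
  then have "0 < ?z \<bullet> (A *v ?z)" using A by (simp add: Sym_pos_def)
  also have "?z \<bullet> (A *v ?z) = axis i 1 \<bullet> ((transpose Z ** A ** Z) *v axis i 1)"
    by (simp only: inner_matrix_vector_transpose[of "axis i 1" "transpose Z"]
        matrix_vector_mul_assoc[symmetric] transpose_transpose)
  also have "\<dots> = d i"
    by (simp add: diag inner_axis' matrix_vector_mult_basis column_def)
  finally show ?thesis .
qed

lemma congruence_inverse:
  fixes K Z :: "real^'n^'n"
  assumes "transpose Z ** K ** Z = mat 1"
  shows "matrix_inv K = Z ** transpose Z"
proof -
  have "Z ** (transpose Z ** K) = mat 1"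
    using assms by (simp add: matrix_left_right_inverse)
  then have "(Z ** transpose Z) ** K = mat 1" by (simp add: matrix_mul_assoc)
  then show ?thesis by (intro matrix_inv_unique) (simp add: matrix_left_right_inverse)
qed

lemma det_pos_Sym_pos:
  fixes K :: "real^'n^'n"
  assumes "K \<in> Sym_pos"
  shows "det K > 0"
proof -
  have "K \<in> Sym" using assms by (simp add: Sym_pos_def)
  then obtain Z :: "real^'n^'n" where Z: "transpose Z ** K ** Z = mat 1"
    by (rule simultaneous_diagonalization[OF assms])
  have "det Z * det Z * det K = 1"
    using arg_cong[OF Z, of det] by (simp add: det_mul mult_ac)
  then show ?thesis
    by (metis zero_less_mult_iff zero_less_one not_square_less_zero)
qed

text \<open>After simultaneous diagonalisation, with \<open>d\<close> the eigenvalues of \<open>L\<close> relative to \<open>K\<close>, both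
  claims are the scalar inequality \<open>ln d \<le> d - 1\<close> with its equality case \<open>d = 1\<close>.\<close>

lemma ln_det_strictly_concave:
  fixes K L :: "real^'n^'n"
  assumes K: "K \<in> Sym_pos" and L: "L \<in> Sym_pos"
  shows "ln (det L) - ln (det K) \<le> matrix_inv K \<bullet> (L - K)"
    and "ln (det L) - ln (det K) = matrix_inv K \<bullet> (L - K) \<Longrightarrow> L = K"
proof -
  have "L \<in> Sym" using L by (simp add: Sym_pos_def)
  then obtain Z :: "real^'n^'n" and d where Z1: "transpose Z ** K ** Z = mat 1"
    and diag: "transpose Z ** L ** Z = (\<chi> i j. if i = j then d i else 0)" and Z2: "invertible Z"
    by (rule simultaneous_diagonalization[OF K])
  note Z = Z1 Z2
  have d: "d i > 0" for i using form_positive_diagonal[OF L Z(2) diag] .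
  have 1: "det Z * det Z * det K = 1"
    using arg_cong[OF Z(1), of det] by (simp add: det_mul mult_ac)
  have 2: "det Z * det Z * det L = (\<Prod>i\<in>UNIV. d i)"
    using arg_cong[OF diag, of det] by (subst (asm) det_diagonal) (simp_all add: det_mul mult_ac)
  have "det L = det L * (det Z * det Z * det K)" by (simp add: 1)
  also have "\<dots> = det K * (\<Prod>i\<in>UNIV. d i)" by (simp add: 2[symmetric])
  finally have "det L = det K * (\<Prod>i\<in>UNIV. d i)" .
  then have lndet: "ln (det L) - ln (det K) = (\<Sum>i\<in>UNIV. ln (d i))"
    using d det_pos_Sym_pos[OF K] by (simp add: ln_mult prod_pos ln_prod less_imp_neq[THEN not_sym])
  have symK: "matrix_inv K \<in> Sym"
    using K Sym_pos_invertible[OF K] by (intro Sym_matrix_inv) (auto simp: Sym_pos_def)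
  have "matrix_inv K \<bullet> A = trace (transpose Z ** A ** Z)" for A
  proof -
    have "matrix_inv K \<bullet> A = trace (Z ** (transpose Z ** A))"
      using trace_Sym_mult[OF symK, of A] by (simp add: congruence_inverse[OF Z(1)] matrix_mul_assoc)
    also have "\<dots> = trace (transpose Z ** A ** Z)" by (rule trace_mul_sym)
    finally show ?thesis .
  qed
  then have tr: "matrix_inv K \<bullet> (L - K) = (\<Sum>i\<in>UNIV. d i - 1)"
    by (simp add: inner_diff_right Z diag trace_def mat_def sum_subtractf)
  have le: "ln (d i) \<le> d i - 1" for i using d[of i] by (rule ln_le_minus_one)
  then show "ln (det L) - ln (det K) \<le> matrix_inv K \<bullet> (L - K)"
    unfolding lndet tr by (intro sum_mono)
  assume "ln (det L) - ln (det K) = matrix_inv K \<bullet> (L - K)"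
  then have "(\<Sum>i\<in>UNIV. (d i - 1) - ln (d i)) = 0"
    unfolding lndet tr by (simp add: sum_subtractf)
  then have "(d i - 1) - ln (d i) = 0" for i
    using le by (subst (asm) sum_nonneg_eq_0_iff) auto
  then have "d i = 1" for i using ln_eq_minus_one[OF d[of i]] by simp
  then have eq: "transpose Z ** L ** Z = transpose Z ** K ** Z"
    by (simp add: diag Z mat_def vec_eq_iff)
  obtain Y where Y: "Z ** Y = mat 1" using Z(2) unfolding invertible_right_inverse by (rule exE)
  have Y': "transpose Y ** transpose Z = mat 1"
    by (simp only: matrix_transpose_mul[symmetric] Y transpose_mat)
  have "transpose Y ** (transpose Z ** A ** Z) ** Y = A" for A
  proof -
    have "transpose Y ** (transpose Z ** A ** Z) ** Y = (transpose Y ** transpose Z) ** A ** (Z ** Y)"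
      by (simp only: matrix_mul_assoc)
    then show ?thesis by (simp only: Y Y' matrix_mul_lid matrix_mul_rid)
  qed
  from this[of L] this[of K] eq show "L = K" by metis
qed

lemma continuous_on_det: 
  fixes f :: "'a::topological_space \<Rightarrow> real^'n^'n"
  assumes "continuous_on S f"
  shows "continuous_on S (\<lambda>x. det (f x))"
  unfolding det_def
  by (intro continuous_on_sum continuous_on_mult continuous_on_const continuous_on_prod
      continuous_on_component assms)

text \<open>By Cramer's rule the entries of the inverse are quotients of determinants.\<close>

lemma continuous_on_matrix_inv:
  fixes f :: "'a::topological_space \<Rightarrow> real^'n^'n"
  assumes f: "continuous_on S f" and inv: "\<And>x. x \<in> S \<Longrightarrow> invertible (f x)"
  shows "continuous_on S (\<lambda>x. matrix_inv (f x))"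
proof -
  define C where "C = (\<lambda>x. \<chi> k l. det (\<chi> i j. if j = k then axis l 1 $ i else f x $ i $ j) / det (f x))"
  have nz: "det (f x) \<noteq> 0" if "x \<in> S" for x using inv[OF that] by (simp add: invertible_det_nz)
  have C: "matrix_inv (f x) = C x" if x: "x \<in> S" for x
  proof -
    have "matrix_inv (f x) $ k $ l = C x $ k $ l" for k l
    proof -
      have "f x *v (matrix_inv (f x) *v axis l 1) = axis l 1"
        by (simp add: matrix_vector_mul_assoc matrix_inv_mult(1)[OF inv[OF x]])
      then have "matrix_inv (f x) *v axis l 1
          = (\<chi> k. det (\<chi> i j. if j = k then axis l 1 $ i else f x $ i $ j) / det (f x))"
        by (rule cramer[OF nz[OF x], THEN iffD1])
      then have "(matrix_inv (f x) *v axis l 1) $ k = C x $ k $ l" by (simp add: C_def)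
      then show ?thesis by (simp add: matrix_vector_mult_basis column_def)
    qed
    then show ?thesis by (simp add: vec_eq_iff)
  qed
  have "continuous_on S C"
    unfolding C_def
  proof (intro continuous_on_vec_lambda continuous_on_divide continuous_on_det f ballI nz)
    show "continuous_on S (\<lambda>x. if j = k then axis l 1 $ i else f x $ i $ j)" for i j k l :: 'n
      by (cases "j = k") (simp_all add: continuous_on_component f)
  qed
  then show ?thesis by (simp only: continuous_on_cong[OF refl C])
qed

section \<open>Norms on Euclidean space\<close>

lemma is_normD:
  assumes "is_norm N"
  shows "N x \<ge> 0" "N x = 0 \<longleftrightarrow> x = 0" "N (c *\<^sub>R x) = \<bar>c\<bar> * N x" "N (x + y) \<le> N x + N y"
    "N 0 = 0" "N (- x) = N x" "N (x - y) \<le> N x + N y"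
proof -
  show "N x \<ge> 0" "N x = 0 \<longleftrightarrow> x = 0" "N (c *\<^sub>R x) = \<bar>c\<bar> * N x" "N 0 = 0"
    and add: "N (x + y) \<le> N x + N y" for x y c
    using assms by (auto simp: is_norm_def)
  show neg: "N (- x) = N x" for x
    using assms unfolding is_norm_def by (metis abs_minus_cancel abs_one mult_1 scaleR_minus1_left)
  show "N (x - y) \<le> N x + N y"
    using add[of x "- y"] by (simp add: neg)
qed

text \<open>On a Euclidean space an arbitrary norm is equivalent to the Euclidean one, which makes the supremum
  in the operator norm finite and balls of the norm compact.\<close>

lemma is_norm_upper:
  fixes N :: "'a::euclidean_space \<Rightarrow> real"
  assumes "is_norm N"
  obtains C where "C > 0" "\<And>x. N x \<le> C * norm x"
proof
  note N = is_normD[OF assms]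
  let ?C = "(\<Sum>b\<in>Basis. N b) + 1"
  show "?C > 0" by (intro add_nonneg_pos sum_nonneg) (auto simp: N)
  fix x
  have le: "N (\<Sum>b\<in>B. f b) \<le> (\<Sum>b\<in>B. N (f b))" if "finite B" for f and B :: "'a set"
    using that
  proof (induction B rule: finite_induct)
    case (insert b B)
    then show ?case using N(4)[of "f b" "sum f B"] by simp
  qed (simp add: N)
  have "N x = N (\<Sum>b\<in>Basis. (x \<bullet> b) *\<^sub>R b)" by (simp add: euclidean_representation)
  also have "\<dots> \<le> (\<Sum>b\<in>Basis. N ((x \<bullet> b) *\<^sub>R b))" by (rule le) simp
  also have "\<dots> \<le> (\<Sum>b\<in>Basis. norm x * N b)"
    by (intro sum_mono) (auto simp: N intro!: mult_right_mono Basis_le_norm)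
  also have "\<dots> \<le> ?C * norm x" unfolding sum_distrib_left[symmetric] by (simp add: algebra_simps)
  finally show "N x \<le> ?C * norm x" .
qed

lemma continuous_on_is_norm:
  fixes N :: "'a::euclidean_space \<Rightarrow> real"
  assumes "is_norm N"
  shows "continuous_on S N"
proof -
  obtain C where C: "C > 0" "\<And>x. N x \<le> C * norm x" using is_norm_upper[OF assms] by blast
  note N = is_normD[OF assms]
  have "C-lipschitz_on S N"
  proof (rule lipschitz_onI)
    fix x y
    have "N x \<le> N y + N (x - y)" "N y \<le> N x + N (x - y)"
      using N(4)[of y "x - y"] N(7)[of x "x - y"] by simp_all
    then show "dist (N x) (N y) \<le> C * dist x y"
      using C(2)[of "x - y"] by (simp add: dist_real_def dist_norm)
  qed (use C in simp)
  then show ?thesis by (rule lipschitz_on_continuous_on)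
qed

lemma is_norm_lower:
  fixes N :: "'a::euclidean_space \<Rightarrow> real"
  assumes "is_norm N"
  obtains m where "m > 0" "\<And>x. m * norm x \<le> N x"
proof -
  note N = is_normD[OF assms]
  have "sphere (0::'a) 1 \<noteq> {}" by simp
  then obtain u :: 'a where u: "u \<in> sphere 0 1" "\<And>y. y \<in> sphere 0 1 \<Longrightarrow> N u \<le> N y"
    using continuous_attains_inf[OF compact_sphere _ continuous_on_is_norm[OF assms]] by metis
  then have "u \<noteq> 0" by auto
  then have pos: "N u > 0" using N(1,2)[of u] by (simp add: order.strict_iff_order)
  have "N u * norm x \<le> N x" for x
  proof (cases "x = 0")
    case False
    then have "x /\<^sub>R norm x \<in> sphere 0 1" by simp
    then have "N u \<le> N x / norm x" using u(2)[of "x /\<^sub>R norm x"] by (simp add: N field_simps)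
    then show ?thesis using False by (simp add: field_simps)
  qed (simp add: N)
  then show ?thesis using that pos by blast
qed

lemma op_norm_bound:
  fixes N :: "real^'n \<Rightarrow> real"
  assumes "is_norm N"
  shows "N (A *v x) \<le> op_norm N A * N x" and "op_norm N A \<ge> 0"
proof -
  note N = is_normD[OF assms]
  obtain C where C: "C > 0" "\<And>x. N x \<le> C * norm x" using is_norm_upper[OF assms] by blast
  obtain m where m: "m > 0" "\<And>x. m * norm x \<le> N x" using is_norm_lower[OF assms] by blast
  obtain B where B: "B > 0" "\<And>x. norm (A *v x) \<le> B * norm x"
    using linear_bounded_pos[OF matrix_vector_mul_linear, of A] by (auto simp: mult.commute)
  have "N (A *v x) / N x \<le> C * B / m" for x
  proof (cases "x = 0")
    case False
    have "N (A *v x) \<le> C * (B * norm x)"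
      using C B(2)[of x] by (meson order.trans mult_left_mono less_imp_le)
    also have "\<dots> = C * B / m * (m * norm x)" using m by simp
    also have "\<dots> \<le> C * B / m * N x" using C B m by (intro mult_left_mono) auto
    finally show ?thesis using False N(1,2)[of x] by (simp add: divide_le_eq order.strict_iff_order)
  qed (use B C m in \<open>simp add: N\<close>)
  then have bdd: "bdd_above (range (\<lambda>x. N (A *v x) / N x))" 
    by (intro bdd_aboveI[of _ "C * B / m"]) auto
  then have le: "N (A *v x) / N x \<le> op_norm N A" for x
    unfolding op_norm_def by (rule cSUP_upper[OF UNIV_I])
  show "N (A *v x) \<le> op_norm N A * N x"
  proof (cases "x = 0")
    case False
    then show ?thesis using le[of x] N(1,2)[of x] by (simp add: divide_le_eq order.strict_iff_order)
  qed (simp add: N)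
  show "op_norm N A \<ge> 0" using le[of 0] by (simp add: N)
qed

section \<open>Orthogonal projections and the Moore-Penrose inverse\<close>

text \<open>Two generalised inverses \<open>B\<close> and \<open>C\<close> with self-adjoint products satisfy \<open>A B = A C\<close> and
  \<open>B A = C A\<close>, since \<open>A B = (A C A B)\<^sup>T = A B A C = A C\<close>; then \<open>B = B A B = C A C = C\<close>.\<close>

lemma moore_penrose_eqI:
  fixes A :: "real^'n^'m"
  assumes "A ** B ** A = A" "B ** A ** B = B"
    "transpose (A ** B) = A ** B" "transpose (B ** A) = B ** A"
  shows "moore_penrose A = B"
  unfolding moore_penrose_def
proof (rule the_equality)
  show "A ** B ** A = A \<and> B ** A ** B = B \<and>
     transpose (A ** B) = A ** B \<and> transpose (B ** A) = B ** A" using assms by blast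
  fix C assume C: "A ** C ** A = A \<and> C ** A ** C = C \<and>
     transpose (A ** C) = A ** C \<and> transpose (C ** A) = C ** A"
  have "A ** B = transpose (A ** C ** A ** B)" using C assms(3) by metis
  also have "\<dots> = (A ** B) ** (A ** C)"
    using C assms(3) by (metis matrix_mul_assoc matrix_transpose_mul)
  also have "\<dots> = A ** C" using assms(1) by (metis matrix_mul_assoc)
  finally have AB: "A ** B = A ** C" .
  have "B ** A = transpose (B ** (A ** C ** A))" using C assms(4) by metis
  also have "\<dots> = (C ** A) ** (B ** A)"
    using C assms(4) by (metis matrix_mul_assoc matrix_transpose_mul)
  also have "\<dots> = C ** A" using assms(1) by (metis matrix_mul_assoc)
  finally have BA: "B ** A = C ** A" .
  show "C = B" using AB BA C assms(2) by (metis matrix_mul_assoc)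
qed

lemma orth_proj_props:
  fixes S :: "'a::euclidean_space set"
  assumes "subspace S"
  shows "orth_proj S x \<in> S" "x - orth_proj S x \<in> S\<^sup>\<bottom>"
  using theI'[OF orth_proj_unique[OF assms, of x]] unfolding orth_proj_def by auto

lemma orth_proj_eqI:
  fixes S :: "'a::euclidean_space set"
  assumes "subspace S" "y \<in> S" "x - y \<in> S\<^sup>\<bottom>"
  shows "orth_proj S x = y"
  using orth_proj_unique[OF assms(1), of x] orth_proj_props[OF assms(1), of x] assms by blast

lemma linear_orth_proj:
  fixes S :: "'a::euclidean_space set"
  assumes S: "subspace S"
  shows "linear (orth_proj S)"
proof
  note p = orth_proj_props[OF S] and T = subspace_orthogonal_comp[of S]
  fix x y
  have "x + y - (orth_proj S x + orth_proj S y) = (x - orth_proj S x) + (y - orth_proj S y)" by simp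
  then show "orth_proj S (x + y) = orth_proj S x + orth_proj S y"
    using p S T by (intro orth_proj_eqI) (metis subspace_add)+
  fix c
  show "orth_proj S (c *\<^sub>R x) = c *\<^sub>R orth_proj S x"
    using p S T by (intro orth_proj_eqI) (metis subspace_scale scaleR_diff_right)+
qed

locale proj_matrix =
  fixes V :: "(real^'n) set" and P :: "real^'n^'n"
  assumes V: "subspace V" and P: "P = matrix (orth_proj V)"
begin

lemma apply_P: "P *v x = orth_proj V x"
  unfolding P by (rule matrix_works[OF linear_matrix_vector_mul_eq[THEN iffD2, OF linear_orth_proj[OF V]]])

lemma P_in: "P *v x \<in> V"
  by (simp add: apply_P orth_proj_props[OF V])

lemma P_fix: "x \<in> V \<Longrightarrow> P *v x = x"
  unfolding apply_P by (rule orth_proj_eqI[OF V]) (simp_all add: subspace_0 subspace_orthogonal_comp)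

lemma P_idem: "P ** P = P"
  by (simp add: matrix_eq matrix_vector_mul_assoc[symmetric] P_fix P_in)

lemma P_self_adjoint: "x \<bullet> (P *v y) = (P *v x) \<bullet> y"
proof -
  have "(x - P *v x) \<bullet> (P *v y) = 0" "(P *v x) \<bullet> (y - P *v y) = 0"
    using orth_proj_props(2)[OF V, folded apply_P] P_in
    by (auto simp: orthogonal_comp_def orthogonal_def inner_commute)
  then show ?thesis by (simp add: inner_diff_left inner_diff_right)
qed

lemma P_transpose: "transpose P = P"
proof -
  have "(transpose P *v x) \<bullet> y = (P *v x) \<bullet> y" for x y
    by (simp only: inner_matrix_vector_transpose[symmetric] P_self_adjoint)
  then have "transpose P *v x = P *v x" for x using vector_eq_rdot by blast
  then show ?thesis unfolding matrix_eq by blast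
qed

lemma P_zero_orthogonal: "P *v x = 0 \<Longrightarrow> y \<in> V \<Longrightarrow> y \<bullet> x = 0"
  by (metis P_fix P_self_adjoint inner_zero_right)

text \<open>The compression \<open>P G P\<close> of a positive definite \<open>G\<close> agrees on \<open>V\<close> with the invertible matrix
  \<open>P G P + (1 - P)\<close>, which commutes with \<open>P\<close>.  Cutting the inverse of the latter down to \<open>V\<close> gives
  the Moore-Penrose inverse, so that the pseudoinverse is a genuine inverse on \<open>V\<close>.\<close>

lemma moore_penrose_compression:
  assumes pos: "\<And>x. x \<noteq> 0 \<Longrightarrow> x \<bullet> (G *v x) > 0"
  defines "R \<equiv> moore_penrose (P ** G ** P)"
  shows "P ** R = R" "P ** G ** R = P" 
proof -
  define H where "H = P ** G ** P + (mat 1 - P)"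
  have PH: "P ** H = P ** G ** P"
    by (simp add: H_def matrix_add_ldistrib matrix_diff_ldistrib matrix_mul_assoc P_idem)
  have HP: "H ** P = P ** G ** P"
    by (simp add: H_def matrix_add_rdistrib matrix_diff_rdistrib matrix_mul_assoc[symmetric] P_idem)
  have "x = 0" if "H *v x = 0" for x
  proof -
    have "P *v (G *v (P *v x)) = 0"
      using that by (metis PH matrix_vector_mul_assoc matrix_vector_mult_0_right)
    then have "(P *v x) \<bullet> (G *v (P *v x)) = 0"
      by (metis P_zero_orthogonal P_in)
    then have Px: "P *v x = 0" using pos[of "P *v x"] by force
    then show ?thesis using that
      by (simp add: H_def matrix_vector_mult_add_rdistrib matrix_vector_mult_diff_rdistrib
          matrix_vector_mul_assoc[symmetric])
  qed
  then have "invertible H" by (metis invertible_left_inverse matrix_left_invertible_ker)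
  then obtain J where J: "H ** J = mat 1" "J ** H = mat 1" by (auto simp: invertible_def)
  have PJ: "P ** J = J ** P"
  proof -
    have "P ** J = J ** (H ** P) ** J" using J by (simp add: matrix_mul_assoc)
    also have "\<dots> = J ** (P ** H) ** J" by (simp add: HP PH)
    also have "\<dots> = J ** P" using J by (simp add: matrix_mul_assoc[symmetric])
    finally show ?thesis .
  qed
  have AB: "P ** G ** P ** (P ** J) = P"
    using J by (simp add: PH[symmetric] matrix_mul_assoc[symmetric])
      (metis HP PH P_idem matrix_mul_assoc matrix_mul_rid)
  have BA: "P ** J ** (P ** G ** P) = P"
    using J by (simp add: PJ HP[symmetric])
      (metis HP PH P_idem matrix_mul_assoc matrix_mul_lid)
  have R: "R = P ** J"
    unfolding R_def
  proof (rule moore_penrose_eqI)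
    show "P ** G ** P ** (P ** J) ** (P ** G ** P) = P ** G ** P"
      unfolding AB by (simp add: matrix_mul_assoc P_idem)
    show "P ** J ** (P ** G ** P) ** (P ** J) = P ** J"
      unfolding BA by (simp add: matrix_mul_assoc P_idem)
    show "transpose (P ** G ** P ** (P ** J)) = P ** G ** P ** (P ** J)"
      unfolding AB by (rule P_transpose)
    show "transpose (P ** J ** (P ** G ** P)) = P ** J ** (P ** G ** P)"
      unfolding BA by (rule P_transpose)
  qed
  show "P ** R = R" by (simp add: R matrix_mul_assoc P_idem)
  show "P ** G ** R = P" using AB by (simp add: R matrix_mul_assoc) (metis P_idem matrix_mul_assoc)
qed

end

section \<open>Vectorisation and the duplication matrix\<close>

definition unvectorize :: "real^('p \<times> 'p) \<Rightarrow> real^'p^'p" where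
  "unvectorize y = (\<chi> i j. y $ (j, i))"

lemma vectorize_unvectorize [simp]: "vectorize (unvectorize y) = y"
  and unvectorize_vectorize [simp]: "unvectorize (vectorize X) = X"
  by (simp_all add: vectorize_def unvectorize_def vec_eq_iff)

lemma vectorize_add: "vectorize (A + B) = vectorize A + vectorize B"
  and vectorize_diff: "vectorize (A - B) = vectorize A - vectorize B"
  and vectorize_scaleR: "vectorize (c *\<^sub>R A) = c *\<^sub>R vectorize A"
  and vectorize_0: "vectorize 0 = 0"
  by (simp_all add: vectorize_def vec_eq_iff)

lemma linear_vectorize: "linear vectorize"
  by (rule linearI) (simp_all add: vectorize_add vectorize_scaleR)

lemma linear_unvectorize: "linear unvectorize"
  by (rule linearI) (simp_all add: unvectorize_def vec_eq_iff)

lemma vectorize_eq_0_iff: "vectorize A = 0 \<longleftrightarrow> A = 0"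
  by (metis unvectorize_vectorize vectorize_0)

lemma inner_vectorize: "vectorize A \<bullet> vectorize B = A \<bullet> B"
  for A B :: "real^'p^'p"
proof -
  have "vectorize A \<bullet> vectorize B = (\<Sum>x\<in>UNIV \<times> UNIV. A $ snd x $ fst x * B $ snd x $ fst x)"
    by (simp add: inner_vec_def vectorize_def)
  also have "\<dots> = (\<Sum>j\<in>UNIV. \<Sum>i\<in>UNIV. A $ i $ j * B $ i $ j)"
    by (simp only: sum.cartesian_product case_prod_unfold)
  also have "\<dots> = A \<bullet> B" unfolding inner_matrix_eq_sum by (rule sum.swap)
  finally show ?thesis .
qed

lemma vectorize_lower_add: "vectorize_lower (A + B) = vectorize_lower A + vectorize_lower B"
  and vectorize_lower_diff: "vectorize_lower (A - B) = vectorize_lower A - vectorize_lower B"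
  and vectorize_lower_scaleR: "vectorize_lower (c *\<^sub>R A) = c *\<^sub>R vectorize_lower A"
  by (simp_all add: vectorize_lower_def vec_eq_iff)

lemma subspace_model_space:
  fixes v :: "'n::finite \<Rightarrow> real^('p::{finite,linorder} lower)"
  shows "subspace (model_space v K)"
proof -
  have "linear (vectorize_lower :: 'p sqmat \<Rightarrow> _)"
    by (rule linearI) (simp_all add: vectorize_lower_add vectorize_lower_scaleR)
  from linear_subspace_vimage[OF this subspace_patt_space]
  have "subspace {K :: 'p sqmat. vectorize_lower K \<in> patt_space v I}" for I
    by (simp add: vimage_def)
  then show ?thesis
    unfolding model_space_def Collect_conj_eq Collect_mem_eq by (rule subspace_inter[OF subspace_Sym])
qed

lemma position_less:
  fixes k :: "'p::{finite,linorder} lower"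
  assumes "CARD('p) \<ge> 2"
  shows "fst (position k) < snd (position k)"
  using position[of k] assms by auto

lemma bij_betw_position:
  assumes "CARD('p::{finite,linorder}) \<ge> 2"
  shows "bij_betw (position :: 'p lower \<Rightarrow> _) UNIV {ji. fst ji < snd ji}"
  by (rule bij_betw_byWitness[where f' = of_position])
     (auto simp: position_inverse of_position_inverse position_less[OF assms])

text \<open>Inverts \<^const>\<open>vectorize_lower\<close> on \<^const>\<open>Sym_zero\<close>.\<close>

definition unlower :: "real^('p::{finite,linorder} lower) \<Rightarrow> 'p sqmat" where
  "unlower y = (\<chi> i j. if j < i then y $ of_position (j, i)
     else if i < j then y $ of_position (i, j) else 0)"

lemma unlower_Sym: "unlower y \<in> Sym" "unlower y $ i $ i = 0"
  by (auto simp: Sym_def unlower_def vec_eq_iff transpose_def)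

lemma vectorize_lower_unlower:
  fixes y :: "real^('p::{finite,linorder} lower)"
  assumes "CARD('p) \<ge> 2"
  shows "vectorize_lower (unlower y) = y"
  using position_less[OF assms]
  by (simp add: vectorize_lower_def unlower_def vec_eq_iff position_inverse)

lemma unlower_vectorize_lower:
  assumes "X \<in> Sym_zero"
  shows "unlower (vectorize_lower X) = X"
proof -
  have "X $ i $ j = X $ j $ i" "X $ i $ i = 0" for i j
    using assms by (auto simp: Sym_zero_def Sym_def transpose_def vec_eq_iff)
  then show ?thesis
    by (auto simp: unlower_def vectorize_lower_def vec_eq_iff of_position_inverse)
qed

lemma duplication_mult:
  fixes y :: "real^('p::{finite,linorder} lower)"
  assumes "CARD('p) \<ge> 2"
  shows "duplication *v y = vectorize (unlower y)"
proof -
  have "\<forall>X\<in>Sym_zero. duplication *v vectorize_lower X = vectorize (X :: 'p sqmat)"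
    unfolding duplication_def by (rule theI'[OF duplication_unique[OF assms]])
  then have "duplication *v vectorize_lower (unlower y) = vectorize (unlower y)"
    by (auto simp: Sym_zero_def unlower_Sym)
  then show ?thesis by (simp add: vectorize_lower_unlower[OF assms])
qed

text \<open>Each pair of mirror-image entries is counted once below and once above the diagonal, hence the factor
  2; it matches the factor 2 in the penalty.\<close>

lemma inner_unlower:
  fixes y :: "real^('p::{finite,linorder} lower)"
  assumes "CARD('p) \<ge> 2" and K: "K \<in> Sym"
  shows "unlower y \<bullet> K = 2 * (y \<bullet> vectorize_lower K)"
proof -
  define g where "g = (\<lambda>ji. unlower y $ snd ji $ fst ji * K $ snd ji $ fst ji)"
  have sym: "K $ i $ j = K $ j $ i" "unlower y $ i $ j = unlower y $ j $ i" for i j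
    using K unlower_Sym(1)[of y] by (auto simp: Sym_def transpose_def vec_eq_iff)
  let ?L = "{ji. fst ji < snd ji}" and ?U = "{ji. snd ji < fst ji}"
  have "unlower y \<bullet> K = (\<Sum>ji\<in>UNIV. g ji)"
    by (simp add: inner_vectorize[symmetric] inner_vec_def vectorize_def g_def)
  also have "\<dots> = (\<Sum>ji\<in>?L \<union> ?U. g ji)"
    by (rule sum.mono_neutral_right) (auto simp: g_def unlower_Sym not_less_iff_gr_or_eq)
  also have "\<dots> = (\<Sum>ji\<in>?L. g ji) + (\<Sum>ji\<in>?U. g ji)"
    by (rule sum.union_disjoint) auto
  also have "(\<Sum>ji\<in>?U. g ji) = (\<Sum>ji\<in>?L. g ji)"
    by (rule sum.reindex_bij_witness[where i = prod.swap and j = prod.swap])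
       (auto simp: g_def sym[of "fst _"])
  also have "(\<Sum>ji\<in>?L. g ji) = (\<Sum>k\<in>UNIV. g (position k))"
    by (rule sum.reindex_bij_betw[OF bij_betw_position[OF assms(1)], symmetric])
  also have "\<dots> = y \<bullet> vectorize_lower K"
    by (simp add: inner_vec_def g_def vectorize_lower_def unlower_def position_less[OF assms(1)]
        position_inverse)
  finally show ?thesis by simp
qed

section \<open>Atomic norms and their duals\<close>

lemma atomic_norm_ge: "v i \<bullet> x \<le> atomic_norm v x"
  unfolding atomic_norm_def by (rule Max_ge) auto

lemma active_nonempty: "active v x \<noteq> {}"
proof -
  have "atomic_norm v x \<in> (\<lambda>i. v i \<bullet> x) ` UNIV"
    unfolding atomic_norm_def by (rule Max_in) auto
  then show ?thesis by (auto simp: active_def)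
qed

lemma atomic_norm_scaleR:
  assumes "c \<ge> 0"
  shows "atomic_norm v (c *\<^sub>R x) = c * atomic_norm v x"
proof -
  obtain i where "v i \<bullet> x = atomic_norm v x"
    using active_nonempty[of v x] by (auto simp: active_def)
  moreover obtain j where "v j \<bullet> (c *\<^sub>R x) = atomic_norm v (c *\<^sub>R x)"
    using active_nonempty[of v "c *\<^sub>R x"] by (auto simp: active_def)
  ultimately show ?thesis
    using atomic_norm_ge[of v i "c *\<^sub>R x"] mult_left_mono[OF atomic_norm_ge[of v j x] assms] by simp
qed

text \<open>A ball around 0 inside the convex hull of the atoms contains a positive multiple of \<open>x\<close>, and the
  linear form \<open>x\<close> is bounded on the hull by its maximum over the atoms.\<close>

lemma atomic_norm_coercive:
  assumes "admissible_atoms v"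
  obtains e where "e > 0" "\<And>x. e * norm x \<le> atomic_norm v x"
proof -
  obtain e where e: "e > 0" "cball 0 e \<subseteq> convex hull range v"
    using assms by (auto simp: admissible_atoms_def mem_interior_cball)
  have "e * norm x \<le> atomic_norm v x" for x
  proof (cases "x = 0")
    case False
    have "(e / norm x) *\<^sub>R x \<in> convex hull range v" using e False by (auto simp: subset_iff)
    moreover have "convex hull range v \<subseteq> {y. x \<bullet> y \<le> atomic_norm v x}"
      by (rule hull_minimal[where S = convex, OF _ convex_halfspace_le]) (auto simp: inner_commute[of x] atomic_norm_ge)
    ultimately have "x \<bullet> ((e / norm x) *\<^sub>R x) \<le> atomic_norm v x" by blast
    then show ?thesis using False by (simp add: dot_square_norm power2_eq_square)
  qed (simp add: atomic_norm_def)
  then show ?thesis using that e(1) by blast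
qed

text \<open>Coercivity of the atomic norm keeps the supremum in the dual gauge finite, so that it bounds the
  values it ranges over.\<close>

lemma dual_gauge_le_1D:
  assumes v: "admissible_atoms v" and y: "dual_gauge v y \<le> 1"
  shows "y \<bullet> x \<le> atomic_norm v x"
proof -
  obtain e where e: "e > 0" "\<And>x. e * norm x \<le> atomic_norm v x"
    using atomic_norm_coercive[OF v] by blast
  have le: "x \<bullet> y \<le> 1" if "atomic_norm v x \<le> 1" for x
  proof -
    have "bdd_above {x \<bullet> y | x. atomic_norm v x \<le> 1}"
    proof (rule bdd_aboveI)
      fix r assume "r \<in> {x \<bullet> y | x. atomic_norm v x \<le> 1}"
      then obtain x where x: "r = x \<bullet> y" "atomic_norm v x \<le> 1" by blast
      have "norm x \<le> 1 / e" using e(1) e(2)[of x] x(2) by (simp add: field_simps)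
      then have "norm x * norm y \<le> 1 / e * norm y" by (intro mult_right_mono) auto
      then show "r \<le> 1 / e * norm y" using norm_cauchy_schwarz[of x y] x(1) by linarith
    qed
    then have "x \<bullet> y \<le> dual_gauge v y"
      unfolding dual_gauge_def by (rule cSup_upper[rotated]) (use that in blast)
    then show ?thesis using y by simp
  qed
  show ?thesis
  proof (cases "x = 0")
    case False
    then have pos: "atomic_norm v x > 0"
      using e(1) e(2)[of x] by (smt (verit) mult_pos_pos zero_less_norm_iff)
    have "atomic_norm v ((1 / atomic_norm v x) *\<^sub>R x) \<le> 1"
      using pos by (subst atomic_norm_scaleR) auto
    from le[OF this] show ?thesis using pos by (simp add: field_simps inner_commute)
  qed (simp add: atomic_norm_def)
qed

lemma face_proj_in: "face_proj v I \<in> patt_space v I"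
  unfolding face_proj_def by (rule orth_proj_props[OF subspace_patt_space])

text \<open>On the pattern subspace the face projection represents the same linear form as any active atom.\<close>

lemma face_proj_inner:
  assumes "i \<in> I" "x \<in> patt_space v I"
  shows "face_proj v I \<bullet> x = v i \<bullet> x"
proof -
  have "v i - face_proj v I \<in> (patt_space v I)\<^sup>\<bottom>"
    unfolding face_proj_eq[OF assms(1)] by (rule orth_proj_props[OF subspace_patt_space])
  then have "x \<bullet> (v i - face_proj v I) = 0"
    using assms(2) by (simp add: orthogonal_comp_def orthogonal_def)
  then show ?thesis by (simp add: inner_diff_right inner_commute)
qed

lemma restricted_dual_gauge_face_proj:
  assumes "I \<noteq> {}"
  shows "restricted_dual_gauge v I (face_proj v I) \<le> 1"
  unfolding restricted_dual_gauge_def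
proof (rule cSup_least)
  have "0 \<in> patt_space v I" "atomic_norm v 0 \<le> 1"
    by (simp_all add: subspace_0[OF subspace_patt_space] atomic_norm_def)
  then show "{x \<bullet> face_proj v I | x. x \<in> patt_space v I \<and> atomic_norm v x \<le> 1} \<noteq> {}" by blast
  obtain i where i: "i \<in> I" using assms by blast
  fix r assume "r \<in> {x \<bullet> face_proj v I | x. x \<in> patt_space v I \<and> atomic_norm v x \<le> 1}"
  then obtain x where x: "r = x \<bullet> face_proj v I" "x \<in> patt_space v I" "atomic_norm v x \<le> 1"
    by blast
  then show "r \<le> 1"
    using face_proj_inner[OF i x(2)] atomic_norm_ge[of v i x] by (simp add: inner_commute)
qed

text \<open>An atom active at \<open>y\<close> lies in the common subdifferential, on which the linear form \<open>x\<close> is constant.\<close>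

lemma same_patt_active:
  assumes "same_patt v x y" "i \<in> active v y"
  shows "v i \<bullet> x = atomic_norm v x"
proof -
  have "v i \<in> subdiff v x"
    using assms by (metis hull_inc imageI same_patt_def subdiff_def)
  moreover have "subdiff v x \<subseteq> {u. x \<bullet> u = atomic_norm v x}"
    unfolding subdiff_def
    by (rule hull_minimal[where S = convex, OF _ convex_hyperplane]) (auto simp: active_def inner_commute[of x])
  ultimately show ?thesis by (auto simp: inner_commute)
qed

section \<open>Perturbation of the inverse covariance\<close>

lemma inner_matrix_eq_trace: "A \<bullet> B = trace (transpose A ** B)"
  for A B :: "real^'n^'m"
proof -
  have "trace (transpose A ** B) = (\<Sum>j\<in>UNIV. \<Sum>i\<in>UNIV. A $ i $ j * B $ i $ j)"
    by (simp add: trace_def matrix_matrix_mult_def transpose_def)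
  also have "\<dots> = A \<bullet> B" unfolding inner_matrix_eq_sum by (rule sum.swap)
  finally show ?thesis by simp
qed

lemma inner_matrix_mult_left: "A \<bullet> (B ** C) = (transpose B ** A) \<bullet> C"
  for A :: "real^'n^'m"
  by (simp add: inner_matrix_eq_trace matrix_transpose_mul matrix_mul_assoc)

lemma inner_matrix_mult_right: "A \<bullet> (B ** C) = (A ** transpose C) \<bullet> B"
  for A :: "real^'n^'m"
proof -
  have "A \<bullet> (B ** C) = trace ((transpose A ** B) ** C)"
    by (simp add: inner_matrix_eq_trace matrix_mul_assoc)
  also have "\<dots> = trace (C ** (transpose A ** B))" by (rule trace_mul_sym)
  also have "\<dots> = (A ** transpose C) \<bullet> B"
    by (simp add: inner_matrix_eq_trace matrix_transpose_mul matrix_mul_assoc)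
  finally show ?thesis .
qed

lemma Sym_pos_matrix_inv:
  fixes A :: "real^'n^'n"
  assumes A: "A \<in> Sym_pos"
  shows "matrix_inv A \<in> Sym_pos"
proof -
  note inv = Sym_pos_invertible[OF A]
  have "0 < x \<bullet> (matrix_inv A *v x)" if "x \<noteq> 0" for x
  proof -
    let ?u = "matrix_inv A *v x"
    have x: "A *v ?u = x" by (simp add: matrix_vector_mul_assoc matrix_inv_mult[OF inv])
    then have "?u \<noteq> 0" using that by auto
    then have "0 < ?u \<bullet> (A *v ?u)" using A by (simp add: Sym_pos_def)
    then show ?thesis by (simp add: x inner_commute)
  qed
  then show ?thesis using Sym_matrix_inv[OF _ inv] A by (simp add: Sym_pos_def)
qed

lemma Sym_pos_factor:
  fixes A :: "real^'n^'n"
  assumes A: "A \<in> Sym_pos" and D: "D \<in> Sym"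
  obtains Z :: "real^'n^'n" and d where "A = Z ** transpose Z" "invertible Z"
    "transpose Z ** matrix_inv A ** Z = mat 1"
    "transpose Z ** D ** Z = (\<chi> i j. if i = j then d i else 0)"
proof -
  obtain Z :: "real^'n^'n" and d where Z: "transpose Z ** matrix_inv A ** Z = mat 1"
    "transpose Z ** D ** Z = (\<chi> i j. if i = j then d i else 0)" "invertible Z"
    using simultaneous_diagonalization[OF Sym_pos_matrix_inv[OF A] D] by blast
  have "matrix_inv A ** A = mat 1" by (simp add: matrix_inv_mult[OF Sym_pos_invertible[OF A]])
  then have "matrix_inv (matrix_inv A) = A" by (rule matrix_inv_unique)
  then have "A = Z ** transpose Z" using congruence_inverse[OF Z(1)] by simp
  with Z show ?thesis by (intro that)
qed

text \<open>With \<open>A = Z Z\<^sup>T\<close> the quadratic form at \<open>vec X\<close> is the squared Frobenius norm of \<open>Z\<^sup>T X Z\<close>.\<close>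

lemma kronecker_Sym_pos:
  fixes A :: "real^'n^'n"
  assumes A: "A \<in> Sym_pos" and x: "x \<noteq> 0"
  shows "x \<bullet> ((A \<otimes>\<^sub>K A) *v x) > 0"
proof -
  define X where "X = unvectorize x"
  have xX: "x = vectorize X" by (simp add: X_def)
  have symA: "A \<in> Sym" using A by (simp add: Sym_pos_def)
  then have t: "transpose A = A" by (simp add: Sym_def)
  obtain Z :: "real^'n^'n" where Z: "A = Z ** transpose Z" "invertible Z"
    using Sym_pos_factor[OF A symA] by blast
  let ?Y = "transpose Z ** X ** Z"
  have "X = 0" if "?Y = 0"
  proof -
    obtain W where W: "Z ** W = mat 1" using Z(2) by (auto simp: invertible_right_inverse)
    have W': "transpose W ** transpose Z = mat 1"
      by (simp only: matrix_transpose_mul[symmetric] W transpose_mat)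
    have "(transpose W ** transpose Z) ** X ** (Z ** W) = transpose W ** ?Y ** W"
      by (simp only: matrix_mul_assoc)
    then show ?thesis by (simp add: W W' that)
  qed
  then have Y: "?Y \<noteq> 0" using x by (auto simp: xX vectorize_0)
  have "x \<bullet> ((A \<otimes>\<^sub>K A) *v x) = X \<bullet> (A ** X ** A)"
    using vectorize_mult[of A X A] inner_vectorize[of X "A ** X ** A"] by (simp add: xX t)
  also have "A ** X ** A = Z ** (?Y ** transpose Z)" by (simp add: Z(1) matrix_mul_assoc)
  also have "X \<bullet> (Z ** (?Y ** transpose Z)) = (transpose Z ** X) \<bullet> (?Y ** transpose Z)"
    by (rule inner_matrix_mult_left)
  also have "\<dots> = ?Y \<bullet> ?Y"
    unfolding inner_matrix_mult_right by simp
  finally show ?thesis using Y by simp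
qed

lemma vectorize_mult_right:
  fixes Y D A :: "real^'n^'n"
  assumes "D \<in> Sym" "A \<in> Sym"
  shows "vectorize (Y ** (D ** A)) = ((A ** D) \<otimes>\<^sub>K mat 1) *v vectorize Y"
  using vectorize_mult[of "mat 1" Y "D ** A"] assms by (simp add: matrix_transpose_mul Sym_def)

text \<open>The eigenvalues \<open>d\<close> of \<open>D\<close> relative to \<open>A\<^sup>-\<^sup>1\<close> are left eigenvalues of \<open>D A\<close>.  A matrix whose
  rows are multiples of a left eigenvector is an eigenvector of \<open>Y \<mapsto> Y D A\<close>, which is the operator
  \<open>A D \<otimes> 1\<close>.  Its operator norm is below 1, so \<open>\<bar>d\<bar> < 1\<close>, and \<open>A\<^sup>-\<^sup>1 + D\<close> has the relative eigenvalues \<open>1 + d > 0\<close>.\<close>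

lemma Sym_pos_perturbation:
  fixes A D :: "real^'n^'n"
  assumes A: "A \<in> Sym_pos" and D: "D \<in> Sym" and N: "is_norm N"
    and small: "op_norm N ((A ** D) \<otimes>\<^sub>K (mat 1 :: real^'n^'n)) < 1"
  shows "matrix_inv A + D \<in> Sym_pos"
proof -
  have symA: "A \<in> Sym" using A by (simp add: Sym_pos_def)
  obtain Z :: "real^'n^'n" and d where Z: "A = Z ** transpose Z" "invertible Z"
    "transpose Z ** matrix_inv A ** Z = mat 1"
    "transpose Z ** D ** Z = (\<chi> i j. if i = j then d i else 0)"
    using Sym_pos_factor[OF A D] by blast
  obtain W where W: "Z ** W = mat 1" using Z(2) by (auto simp: invertible_right_inverse)
  have W': "transpose Z ** transpose W = mat 1"
    by (simp only: matrix_transpose_mul[symmetric] W matrix_left_right_inverse transpose_mat)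
       (metis W matrix_left_right_inverse transpose_mat)
  have d: "\<bar>d i\<bar> < 1" for i
  proof -
    \<comment> \<open>the only nonzero row of \<open>Y\<close> is the \<open>i\<close>-th column of \<open>Z\<close>, a left eigenvector of \<open>D A\<close>\<close>
    define E :: "real^'n^'n" where "E = (\<chi> a b. if a = i \<and> b = i then 1 else 0)"
    define Y where "Y = E ** transpose Z"
    have "(E ** (\<chi> i j. if i = j then d i else 0)) $ a $ b = E $ a $ b * d b" for a b
      by (simp add: matrix_matrix_mult_def if_distrib[of "(*) _"] cong: if_cong)
    then have "E ** (\<chi> i j. if i = j then d i else 0) = d i *\<^sub>R E"
      by (simp add: E_def vec_eq_iff)
    moreover have "Y ** (D ** A) = E ** (transpose Z ** D ** Z) ** transpose Z"
      by (simp add: Y_def Z(1) matrix_mul_assoc)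
    ultimately have "Y ** (D ** A) = d i *\<^sub>R Y"
      by (simp add: Z(4) Y_def scalar_matrix_assoc)
    then have "((A ** D) \<otimes>\<^sub>K mat 1) *v vectorize Y = d i *\<^sub>R vectorize Y"
      by (simp add: vectorize_mult_right[OF D symA, symmetric] vectorize_scaleR)
    then have le: "\<bar>d i\<bar> * N (vectorize Y)
        \<le> op_norm N ((A ** D) \<otimes>\<^sub>K (mat 1 :: real^'n^'n)) * N (vectorize Y)"
      using op_norm_bound(1)[OF N] is_normD(3)[OF N] by metis
    have "Y \<noteq> 0"
    proof
      assume "Y = 0"
      then have "E ** (transpose Z ** transpose W) = 0" by (simp add: Y_def matrix_mul_assoc)
      then have "E $ i $ i = 0" by (simp add: W')
      then show False by (simp add: E_def)
    qed
    then have "N (vectorize Y) > 0"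
      using is_normD(1,2)[OF N, of "vectorize Y"] by (simp add: vectorize_eq_0_iff order.strict_iff_order)
    then show ?thesis using le small by (meson le_less_trans mult_le_cancel_right_pos)
  qed
  have "0 < x \<bullet> ((matrix_inv A + D) *v x)" if x: "x \<noteq> 0" for x
  proof -
    define y where "y = W *v x"
    have xy: "x = Z *v y" by (simp add: y_def matrix_vector_mul_assoc W)
    then have "y \<noteq> 0" using x by auto
    then obtain k where k: "y $ k \<noteq> 0" by (auto simp: vec_eq_iff)
    have "x \<bullet> ((matrix_inv A + D) *v x) = y \<bullet> ((transpose Z ** (matrix_inv A + D) ** Z) *v y)"
      by (simp only: xy inner_matrix_vector_transpose[of y "transpose Z"]
          matrix_vector_mul_assoc[symmetric] transpose_transpose)
    also have "transpose Z ** (matrix_inv A + D) ** Z = (\<chi> i j. if i = j then 1 + d i else 0)"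
      by (simp add: matrix_add_ldistrib matrix_add_rdistrib Z(3,4)) (simp add: vec_eq_iff mat_def)
    also have "y \<bullet> (\<dots> *v y) = (\<Sum>i\<in>UNIV. (1 + d i) * (y $ i)\<^sup>2)"
      by (simp add: inner_vec_def matrix_vector_mult_def if_distrib if_distribR power2_eq_square mult_ac
          cong: if_cong)
    also have "\<dots> > 0"
    proof (rule sum_pos2[of UNIV k])
      show "0 \<le> (1 + d i) * (y $ i)\<^sup>2" for i using d[of i] by (intro mult_nonneg_nonneg) auto
      show "0 < (1 + d k) * (y $ k)\<^sup>2" using d[of k] k by (intro mult_pos_pos) auto
    qed auto
    finally show ?thesis .
  qed
  moreover have "matrix_inv A + D \<in> Sym"
    using Sym_pos_matrix_inv[OF A] D subspace_add[OF subspace_Sym] by (auto simp: Sym_pos_def)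
  ultimately show ?thesis by (simp add: Sym_pos_def)
qed

text \<open>The error of the first order expansion of \<open>(A\<^sup>-\<^sup>1 + D)\<^sup>-\<^sup>1\<close> at \<open>D = 0\<close>.\<close>

definition inverse_remainder :: "real^'n^'n \<Rightarrow> real^'n^'n \<Rightarrow> real^'n^'n" where
  "inverse_remainder A D = matrix_inv (matrix_inv A + D) - A + A ** D ** A"

text \<open>The remainder \<open>R\<close> satisfies \<open>R = (A D A) D A - R D A\<close>, and multiplication by \<open>D A\<close> from the
  right has norm at most \<open>a\<close>.\<close>

lemma inverse_remainder_bound:
  fixes A D :: "real^'n^'n"
  assumes A: "A \<in> Sym_pos" and D: "D \<in> Sym" and N: "is_norm N"
    and small: "op_norm N ((A ** D) \<otimes>\<^sub>K (mat 1 :: real^'n^'n)) \<le> a" "a < 1"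
  shows "(1 - a) * N (vectorize (inverse_remainder A D)) \<le> a * N ((A \<otimes>\<^sub>K A) *v vectorize D)"
proof -
  let ?R = "inverse_remainder A D" and ?B = "(A ** D) \<otimes>\<^sub>K (mat 1 :: real^'n^'n)"
  let ?J = "matrix_inv (matrix_inv A + D)"
  have symA: "A \<in> Sym" using A by (simp add: Sym_pos_def)
  have "matrix_inv A + D \<in> Sym_pos" using small by (intro Sym_pos_perturbation[OF A D N]) simp
  then have "?J ** (matrix_inv A + D) ** A = A"
    by (simp add: matrix_inv_mult Sym_pos_invertible)
  then have J: "?J + ?J ** (D ** A) = A"
    by (simp add: matrix_add_ldistrib matrix_add_rdistrib matrix_mul_assoc[symmetric]
        matrix_inv_mult Sym_pos_invertible[OF A])
  have "?R + ?R ** (D ** A) = (?J + ?J ** (D ** A)) - A + A ** D ** A ** (D ** A)"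
    by (simp add: inverse_remainder_def matrix_add_rdistrib matrix_diff_rdistrib matrix_mul_assoc)
  then have "?R = A ** D ** A ** (D ** A) - ?R ** (D ** A)" by (simp add: J eq_diff_eq)
  then have "vectorize ?R = ?B *v vectorize (A ** D ** A) - ?B *v vectorize ?R"
    by (metis vectorize_diff vectorize_mult_right[OF D symA])
  moreover have "vectorize (A ** D ** A) = (A \<otimes>\<^sub>K A) *v vectorize D"
    using vectorize_mult[of A D A] symA by (simp add: Sym_def)
  ultimately have "vectorize ?R = ?B *v ((A \<otimes>\<^sub>K A) *v vectorize D) - ?B *v vectorize ?R" by simp
  then have "N (vectorize ?R) \<le> N (?B *v ((A \<otimes>\<^sub>K A) *v vectorize D)) + N (?B *v vectorize ?R)"
    by (metis is_normD(7)[OF N])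
  also have "\<dots> \<le> a * N ((A \<otimes>\<^sub>K A) *v vectorize D) + a * N (vectorize ?R)"
    using op_norm_bound(1)[OF N, of ?B] small(1) is_normD(1)[OF N]
    by (meson add_mono mult_right_mono order_trans)
  finally show ?thesis by (simp add: algebra_simps)
qed

section \<open>The graphical lasso and its restriction to a linear model\<close>

text \<open>By \<open>sub\<close> and \<open>att\<close> the vector \<open>y\<close> is a subgradient of the atomic norm at \<open>vec\<^sub>+(K)\<close>.  With
  \<open>stat\<close> the trace term and the penalty term of the objective together grow from \<open>K\<close> to \<open>L\<close> by at least
  \<open>\<langle>K\<^sup>-\<^sup>1, L - K\<rangle>\<close>, which exceeds the growth of \<open>ln det\<close> unless \<open>L = K\<close>.\<close>

lemma glasso_unique_minimizer:
  fixes v :: "'n::finite \<Rightarrow> real^('p::{finite,linorder} lower)" and K S :: "'p sqmat"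
  assumes p: "CARD('p) \<ge> 2" and K: "K \<in> Sym_pos" and S: "S \<in> Sym" and l: "l \<ge> 0"
    and sub: "\<And>x. y \<bullet> x \<le> atomic_norm v x"
    and att: "y \<bullet> vectorize_lower K = atomic_norm v (vectorize_lower K)"
    and stat: "matrix_inv K - S = l *\<^sub>R unlower y"
  shows "is_arg_min (glasso_objective v l S) (\<lambda>K. K \<in> Sym_pos) L \<longleftrightarrow> L = K"
proof -
  let ?f = "glasso_objective v l S"
  have gap: "matrix_inv K \<bullet> (L - K) - (ln (det L) - ln (det K)) \<le> ?f L - ?f K"
    if L: "L \<in> Sym_pos" for L
  proof -
    have sym: "L - K \<in> Sym"
      using K L by (intro subspace_diff[OF subspace_Sym]) (simp_all add: Sym_pos_def)
    have "(matrix_inv K - S) \<bullet> (L - K) = l * (2 * (y \<bullet> vectorize_lower (L - K)))"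
      by (simp add: stat inner_unlower[OF p sym])
    also have "\<dots> \<le> l * (pen v L - pen v K)"
      using sub[of "vectorize_lower L"] att l
      by (intro mult_left_mono) (simp_all add: pen_def vectorize_lower_diff inner_diff_right)
    finally show ?thesis
      by (simp add: glasso_objective_def trace_Sym_mult[OF S] inner_diff_left inner_diff_right
          algebra_simps)
  qed
  have le: "?f K \<le> ?f L" if "L \<in> Sym_pos" for L
    using gap[OF that] ln_det_strictly_concave(1)[OF K that] by simp
  have "L = K" if "L \<in> Sym_pos" "?f L \<le> ?f K"
    using gap[OF that(1)] ln_det_strictly_concave[OF K that(1)] that(2) by simp
  then show ?thesis
    using le K by (auto simp: is_arg_min_def not_less)
qed

text \<open>Brouwer's theorem for the map \<open>F\<close> on the ball of radius \<open>r/\<eta>\<close> of the norm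
  \<open>\<parallel>\<Gamma> vec D\<parallel>\<close> on \<open>V\<close>; hypothesis \<open>w\<close> is what makes \<open>F\<close> map this ball into itself.  The inequality in
  it is strict and so is the resulting bound on the fixed point.\<close>

lemma restricted_stationary_point_exists:
  fixes Sig :: "real^'p^'p" and V :: "(real^'p^'p) set"
  assumes Sig: "Sig \<in> Sym_pos" and V: "subspace V" "V \<subseteq> Sym" and N: "is_norm N"
    and R: "\<And>x. R *v x \<in> vectorize ` V"
    and \<eta>: "\<eta> > 0" "\<And>D. D \<in> V \<Longrightarrow> op_norm N ((Sig ** D) \<otimes>\<^sub>K (mat 1 :: real^'p^'p))
          \<le> \<eta> * N ((Sig \<otimes>\<^sub>K Sig) *v vectorize D)"
    and r: "0 < r" "r < 1"
    and w: "op_norm N ((Sig \<otimes>\<^sub>K Sig) ** R) * (N w + r\<^sup>2 / (\<eta> * (1 - r))) < r / \<eta>"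
  obtains D where "D \<in> V" "vectorize D = R *v (w + vectorize (inverse_remainder Sig D))"
    "N ((Sig \<otimes>\<^sub>K Sig) *v vectorize D) < r / \<eta>"
    "N (vectorize (inverse_remainder Sig D)) \<le> r\<^sup>2 / (\<eta> * (1 - r))"
    "matrix_inv Sig + D \<in> Sym_pos"
proof -
  let ?G = "Sig \<otimes>\<^sub>K Sig" and ?op = "\<lambda>D. op_norm N ((Sig ** D) \<otimes>\<^sub>K (mat 1 :: real^'p^'p))"
  define gn where "gn = (\<lambda>D. N (?G *v vectorize D))"
  define C where "C = {D \<in> V. gn D \<le> r / \<eta>}"
  define F where "F = (\<lambda>D. unvectorize (R *v (w + vectorize (inverse_remainder Sig D))))"
  have G0: "?G *v x = 0 \<Longrightarrow> x = 0" for x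
    using kronecker_Sym_pos[OF Sig, of x] by force
  have gn: "is_norm gn"
    unfolding is_norm_def gn_def
  proof (intro conjI allI)
    fix A B and c :: real
    show "0 \<le> N (?G *v vectorize A)" by (rule is_normD[OF N])
    show "(N (?G *v vectorize A) = 0) = (A = 0)"
      using G0[of "vectorize A"] by (auto simp: is_normD[OF N] vectorize_eq_0_iff vectorize_0)
    show "N (?G *v vectorize (c *\<^sub>R A)) = \<bar>c\<bar> * N (?G *v vectorize A)"
      by (simp add: vectorize_scaleR matrix_vector_mult_scaleR is_normD[OF N])
    show "N (?G *v vectorize (A + B)) \<le> N (?G *v vectorize A) + N (?G *v vectorize B)"
      by (simp add: vectorize_add matrix_vector_right_distrib is_normD[OF N])
  qed
  note gnD = is_normD[OF gn]
  have op: "?op D \<le> r" if "D \<in> C" for D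
  proof -
    have "?op D \<le> \<eta> * gn D" using that \<eta>(2) by (auto simp: C_def gn_def)
    also have "\<dots> \<le> r" using that \<eta>(1) by (simp add: C_def field_simps)
    finally show ?thesis .
  qed
  have symD: "D \<in> Sym" if "D \<in> C" for D using that V by (auto simp: C_def)
  have pos: "matrix_inv Sig + D \<in> Sym_pos" if "D \<in> C" for D
    using op[OF that] r(2) by (intro Sym_pos_perturbation[OF Sig symD[OF that] N]) simp
  have rem: "N (vectorize (inverse_remainder Sig D)) \<le> r\<^sup>2 / (\<eta> * (1 - r))" if "D \<in> C" for D
  proof -
    have "(1 - r) * N (vectorize (inverse_remainder Sig D)) \<le> r * gn D"
      unfolding gn_def by (rule inverse_remainder_bound[OF Sig symD[OF that] N op[OF that] r(2)])
    also have "\<dots> \<le> r * (r / \<eta>)" using that r by (intro mult_left_mono) (auto simp: C_def)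
    finally show ?thesis using r \<eta>(1) by (simp add: power2_eq_square field_simps)
  qed
  have into: "gn (F D) < r / \<eta>" if "D \<in> C" for D
  proof -
    have "gn (F D) = N ((?G ** R) *v (w + vectorize (inverse_remainder Sig D)))"
      by (simp add: gn_def F_def matrix_vector_mul_assoc)
    also have "\<dots> \<le> op_norm N (?G ** R) * N (w + vectorize (inverse_remainder Sig D))"
      by (rule op_norm_bound(1)[OF N])
    also have "\<dots> \<le> op_norm N (?G ** R) * (N w + r\<^sup>2 / (\<eta> * (1 - r)))"
      using is_normD(4)[OF N, of w "vectorize (inverse_remainder Sig D)"] rem[OF that]
      by (intro mult_left_mono op_norm_bound(2)[OF N]) simp
    finally show ?thesis using w by simp
  qed
  have FV: "F D \<in> V" for D
  proof -
    obtain E where "E \<in> V" "R *v (w + vectorize (inverse_remainder Sig D)) = vectorize E"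
      using R by blast
    then show ?thesis by (simp add: F_def)
  qed
  have "compact C"
  proof -
    obtain m where m: "m > 0" "\<And>x. m * norm x \<le> gn x" using is_norm_lower[OF gn] by blast
    have "norm D \<le> r / \<eta> / m" if "D \<in> C" for D
    proof -
      have "norm D * m \<le> r / \<eta>" using m(2)[of D] that by (simp add: C_def mult.commute)
      with m(1) show ?thesis by (simp only: pos_le_divide_eq)
    qed
    then have "bounded C" by (auto simp: bounded_iff)
    moreover have "closed {D. gn D \<le> r / \<eta>}"
      by (intro closed_Collect_le continuous_on_is_norm[OF gn] continuous_on_const)
    then have "closed C"
      using closed_subspace[OF V(1)] unfolding C_def Collect_conj_eq by (simp add: closed_Int)
    ultimately show ?thesis by (simp add: compact_eq_bounded_closed)
  qed
  moreover have "convex C"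
  proof (rule convexI)
    fix A B and s t :: real
    assume AB: "A \<in> C" "B \<in> C" and st: "0 \<le> s" "0 \<le> t" "s + t = 1"
    have "gn (s *\<^sub>R A + t *\<^sub>R B) \<le> s * gn A + t * gn B"
      using gnD(4)[of "s *\<^sub>R A" "t *\<^sub>R B"] st by (simp add: gnD)
    also have "\<dots> \<le> s * (r / \<eta>) + t * (r / \<eta>)"
      using AB st by (intro add_mono mult_left_mono) (auto simp: C_def)
    also have "\<dots> = r / \<eta>" using st(3) by (metis distrib_right mult_1)
    finally show "s *\<^sub>R A + t *\<^sub>R B \<in> C"
      using AB V(1) by (simp add: C_def subspace_add subspace_scale)
  qed
  moreover have "0 \<in> C" using r \<eta>(1) V(1) by (simp add: C_def gnD subspace_0)
  then have "C \<noteq> {}" by blast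
  moreover have "continuous_on C F"
  proof -
    have "continuous_on C (\<lambda>D. matrix_inv (matrix_inv Sig + D))"
      by (intro continuous_on_matrix_inv continuous_on_add continuous_on_const continuous_on_id
          Sym_pos_invertible pos)
    moreover have "linear (\<lambda>D. Sig ** D ** Sig)"
      by (rule linearI)
         (simp_all add: matrix_add_ldistrib matrix_add_rdistrib matrix_scalar_ac scalar_matrix_assoc)
    then have "continuous_on C (\<lambda>D. Sig ** D ** Sig)"
      by (rule linear_continuous_on[OF linear_conv_bounded_linear[THEN iffD1]])
    ultimately have "continuous_on C (inverse_remainder Sig)"
      unfolding inverse_remainder_def[abs_def]
      by (intro continuous_on_add continuous_on_diff continuous_on_const)
    then have "continuous_on C (\<lambda>D. w + vectorize (inverse_remainder Sig D))"
      by (intro continuous_on_add continuous_on_const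
          linear_continuous_on_compose[OF _ linear_vectorize])
    then have "continuous_on C (\<lambda>D. R *v (w + vectorize (inverse_remainder Sig D)))"
      by (rule linear_continuous_on_compose) (rule matrix_vector_mul_linear)
    then show ?thesis
      unfolding F_def by (rule linear_continuous_on_compose[OF _ linear_unvectorize])
  qed
  moreover have "F \<in> C \<rightarrow> C" using into FV by (force simp: C_def)
  ultimately obtain D where D: "D \<in> C" "F D = D" using brouwer by metis
  have "vectorize D = vectorize (F D)" by (simp add: D(2))
  then have "vectorize D = R *v (w + vectorize (inverse_remainder Sig D))"
    by (simp add: F_def)
  moreover have "N (?G *v vectorize D) < r / \<eta>" using into[OF D(1)] D(2) by (simp add: gn_def)
  ultimately show ?thesis using that[of D] D(1) rem[OF D(1)] pos[OF D(1)] by (auto simp: C_def)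
qed

lemma Sym_zero_orthogonal_diagonal:
  fixes E :: "real^'p^'p"
  assumes "E \<in> Sym" and "\<And>i. axis i (axis i 1) \<bullet> E = 0"
  shows "E \<in> Sym_zero"
  using assms by (simp add: Sym_zero_def inner_axis')

text \<open>The atomic norm does not see the diagonal.  This is why a residual orthogonal to the model space has
  zero diagonal, as is needed to write it as \<open>D \<pi>\<close>.\<close>

lemma diagonal_in_model_space:
  fixes v :: "'n::finite \<Rightarrow> real^('p::{finite,linorder} lower)"
  assumes "CARD('p) \<ge> 2"
  shows "axis i (axis i 1) \<in> model_space v K"
proof -
  have "snd (position k) = i \<longrightarrow> fst (position k) \<noteq> i" for k :: "'p lower"
    using position_less[OF assms, of k] by auto
  then have "vectorize_lower (axis i (axis i 1) :: 'p sqmat) = 0"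
    by (simp add: vectorize_lower_def vec_eq_iff axis_def)
  moreover have "axis i (axis i 1) \<in> Sym"
    by (auto simp: Sym_def transpose_def axis_def vec_eq_iff)
  ultimately show ?thesis
    by (simp add: model_space_def subspace_0[OF subspace_patt_space])
qed

lemma unlower_in_model_space:
  fixes v :: "'n::finite \<Rightarrow> real^('p::{finite,linorder} lower)"
  assumes "CARD('p) \<ge> 2" "y \<in> patt_space v (active v (vectorize_lower K))"
  shows "unlower y \<in> model_space v K"
  using assms by (simp add: model_space_def unlower_Sym vectorize_lower_unlower)

text \<open>With \<open>t = sqrt (1 + M)\<close> the radius is \<open>s = (t - 1) / t\<close> and \<open>M = t\<^sup>2 - 1\<close>.
  The identity shows that the first case in the definition of \<open>\<delta>\<close> is \<open>sM/\<eta> - s\<^sup>2 / (\<eta>(1 - s))\<close>.\<close>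

lemma radius_deviation_balance:
  fixes M :: real
  assumes "M > 0"
  defines "s \<equiv> 1 - 1 / sqrt (1 + M)"
  shows "0 < s" "s < 1" "s * M - s\<^sup>2 / (1 - s) = (sqrt (1 + M) - 1)\<^sup>2"
proof -
  define t where "t = sqrt (1 + M)"
  have t: "t > 1" "t\<^sup>2 = 1 + M" using assms(1) by (simp_all add: t_def)
  have s: "s = (t - 1) / t" "1 - s = 1 / t" using t(1) by (simp_all add: s_def t_def[symmetric] field_simps)
  show "0 < s" "s < 1" using t(1) by (simp_all add: s(1))
  have M: "M = t\<^sup>2 - 1" using t(2) by simp
  have "(t - 1) / t * (t\<^sup>2 - 1) - ((t - 1) / t)\<^sup>2 / (1 / t) = (t - 1)\<^sup>2"
    using t(1) by (simp add: power2_eq_square field_simps)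
  then show "s * M - s\<^sup>2 / (1 - s) = (sqrt (1 + M) - 1)\<^sup>2"
    unfolding t_def[symmetric] s(2) unfolding s(1) M[symmetric] .
qed

section \<open>Pattern recovery\<close>

lemma zeta_pos_or_undefined: "zeta v N Sig = -\<infinity> \<or> zeta v N Sig > 0"
proof -
  have *: "Sup (ereal ` Z) = -\<infinity> \<or> Sup (ereal ` Z) > 0" if pos: "Z \<subseteq> {0<..}" for Z
  proof (cases "Z = {}")
    case False
    then obtain z where "z \<in> Z" by blast
    then have "ereal z \<le> Sup (ereal ` Z)" "ereal z > 0" using pos by (auto intro: Sup_upper)
    then show ?thesis by (metis less_le_trans)
  qed (simp add: bot_ereal_def)
  show ?thesis unfolding zeta_def Let_def by (rule *) auto
qed

lemma same_patt_mat_below_zeta: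
  assumes "K \<in> model_space v (matrix_inv Sig)"
    and "ereal (N ((Sig \<otimes>\<^sub>K Sig) *v vectorize (K - matrix_inv Sig))) < zeta v N Sig"
  shows "same_patt_mat v K (matrix_inv Sig)"
  using assms unfolding zeta_def Let_def less_Sup_iff by force

lemma dual_gauge_below_tau:
  assumes "\<pi> \<in> (patt_space v I)\<^sup>\<bottom>" and "ereal (N (duplication *v \<pi>)) < tau v N I"
  shows "dual_gauge v (face_proj v I + \<pi>) \<le> 1"
  using assms unfolding tau_def less_Sup_iff by force

text \<open>A positive \<open>\<delta>\<close> rules out the degenerate values: if \<open>\<zeta> = -\<infinity>\<close> or \<open>M = 0\<close>, then \<open>\<delta> = 0\<close>.
  (For \<open>\<zeta> = -\<infinity>\<close> because \<^const>\<open>real_of_ereal\<close> sends infinite values to 0.)  Otherwise both cases in the definition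
  of \<open>\<delta>\<close> are the same function of \<open>r\<close>.\<close>

lemma tuning_constants:
  fixes M r rstar \<delta> \<eta> :: real and \<zeta> :: ereal
  assumes M: "M \<ge> 0" and \<eta>: "\<eta> > 0" and \<delta>0: "\<delta> > 0" and \<zeta>: "\<zeta> = -\<infinity> \<or> \<zeta> > 0"
    and rstar: "rstar = 1 - 1 / sqrt (1 + M)"
    and r: "r = real_of_ereal (min (ereal rstar) (ereal \<eta> * \<zeta>))"
    and \<delta>: "\<delta> = (if ereal rstar \<le> ereal \<eta> * \<zeta> then (sqrt (1 + M) - 1)\<^sup>2 / \<eta>
             else M * real_of_ereal \<zeta> - \<eta> * (real_of_ereal \<zeta>)\<^sup>2 / (1 - \<eta> * real_of_ereal \<zeta>))"
  shows "M > 0" "0 < r" "r \<le> rstar" "r < 1" "ereal (r / \<eta>) \<le> \<zeta>"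
    "\<delta> = r * M / \<eta> - r\<^sup>2 / (\<eta> * (1 - r))"
proof -
  have "\<zeta> \<noteq> -\<infinity>"
  proof
    assume "\<zeta> = -\<infinity>"
    then have "\<delta> = 0" using \<eta> by (simp add: \<delta>)
    then show False using \<delta>0 by simp
  qed
  then have \<zeta>pos: "\<zeta> > 0" using \<zeta> by blast
  have "M \<noteq> 0"
  proof
    assume "M = 0"
    moreover have "0 \<le> ereal \<eta> * \<zeta>" using \<eta> \<zeta>pos by (simp add: less_imp_le)
    ultimately have "\<delta> = 0" by (simp add: \<delta> rstar zero_ereal_def[symmetric])
    then show False using \<delta>0 by simp
  qed
  then show "M > 0" using M by simp
  note bal = radius_deviation_balance[OF this, folded rstar]
  have "0 < r \<and> r \<le> rstar \<and> ereal (r / \<eta>) \<le> \<zeta> \<and> \<delta> = r * M / \<eta> - r\<^sup>2 / (\<eta> * (1 - r))"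
  proof (cases "ereal rstar \<le> ereal \<eta> * \<zeta>")
    case True
    then have req: "r = rstar" by (simp add: r min_def)
    have "ereal (r / \<eta>) \<le> \<zeta>"
      using True \<eta> by (cases \<zeta>) (auto simp: req field_simps)
    moreover have "r * M / \<eta> - r\<^sup>2 / (\<eta> * (1 - r)) = (r * M - r\<^sup>2 / (1 - r)) / \<eta>"
      by (simp add: diff_divide_distrib)
    ultimately show ?thesis using True bal by (simp add: req \<delta>)
  next
    case False
    then have "\<zeta> \<noteq> \<infinity>" using \<eta> by auto
    then obtain z where z: "\<zeta> = ereal z" "z > 0" using \<zeta>pos by (cases \<zeta>) auto
    then have req: "r = \<eta> * z" using False by (simp add: r min_def)
    have "\<delta> = M * z - \<eta> * z\<^sup>2 / (1 - \<eta> * z)" using False by (simp add: \<delta> z(1))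
    also have "\<dots> = r * M / \<eta> - r\<^sup>2 / (\<eta> * (1 - r))"
      using \<eta> by (simp add: req power2_eq_square)
    finally show ?thesis using False z \<eta> by (simp add: req)
  qed
  then show "0 < r" "r \<le> rstar" "r < 1" "ereal (r / \<eta>) \<le> \<zeta>"
    "\<delta> = r * M / \<eta> - r\<^sup>2 / (\<eta> * (1 - r))" using bal by auto
qed

theorem theorem3p4:
  fixes v :: "'n::finite \<Rightarrow> real^('p::{finite,linorder} lower)"
    and nrm :: "real^('p \<times> 'p) \<Rightarrow> real"
    and P :: "'w measure" and X :: "'w \<Rightarrow> (real,'p) vec" and Xs :: "nat \<Rightarrow> 'w \<Rightarrow> (real,'p) vec"
    and n :: nat and w :: 'w
    and Sig Ks Sighat :: "'p sqmat"
    and Is :: "'n set" and Ss :: "(real^('p lower)) set" and Ms :: "('p sqmat) set"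
    and Gam PM Gam11 Gam21 Q :: "real^('p \<times> 'p)^('p \<times> 'p)"
    and \<tau> c \<eta> \<alpha> M rstar r \<delta> lam :: real and \<zeta> :: ereal
  assumes p: "CARD('p) \<ge> 2"
    and atoms: "admissible_atoms v"
    and nrm: "is_norm nrm"
    and prob: "prob_space P"
    and X_meas: "X \<in> borel_measurable P"
    and X_moments: "\<And>i. integrable P (\<lambda>w. (X w $ i)\<^sup>2)"
    and X_mean: "\<And>i. integral\<^sup>L P (\<lambda>w. X w $ i) = 0"
    and Sig: "Sig = cov_matrix P X" and Sig_pos: "Sig \<in> Sym_pos"
    and Xs: "iid_copies P {1..n} Xs X" and n: "n \<ge> 1"
    and w: "w \<in> space P"
    and Sighat: "Sighat = sample_cov n (\<lambda>k. Xs k w)"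
    and Ks: "Ks = matrix_inv Sig"
    and Is: "Is = active v (vectorize_lower Ks)"
    and Ss: "Ss = patt_space v Is"
    and Ms: "Ms = model_space v Ks"
    and Gam: "Gam = Sig \<otimes>\<^sub>K Sig"
    and PM: "PM = matrix (orth_proj (vectorize ` Ms))"
    and Gam11: "Gam11 = PM ** Gam ** PM"
    and Gam21: "Gam21 = (mat 1 - PM) ** Gam ** PM"
    and Q: "Q = Gam ** moore_penrose Gam11"
    and \<zeta>: "\<zeta> = zeta v nrm Sig"
    and c: "c \<ge> 0" "\<And>\<pi>. \<pi> \<in> Ss \<Longrightarrow> nrm (duplication *v \<pi>) \<le> c * restricted_dual_gauge v Is \<pi>"
    and \<eta>: "\<eta> > 0" "\<And>\<Delta>. \<Delta> \<in> Ms \<Longrightarrow>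
           op_norm nrm ((Sig ** \<Delta>) \<otimes>\<^sub>K (mat 1 :: 'p sqmat)) \<le> \<eta> * nrm (Gam *v vectorize \<Delta>)"
    and tau_pos: "0 < tau v nrm Is" and tau_fin: "tau v nrm Is < \<infinity>"
    and \<tau>: "\<tau> = real_of_ereal (tau v nrm Is)"
    and \<alpha>: "\<alpha> > 0"
    and irr: "nrm ((Gam21 ** moore_penrose Gam11) *v (duplication *v face_proj v Is)) \<le> (1 - \<alpha>) * \<tau>"
    and M: "M = \<alpha> * \<tau> / (op_norm nrm Q * (op_norm nrm (mat 1 - Q) * c + \<alpha> * \<tau>))"
    and rstar: "rstar = 1 - 1 / sqrt (1 + M)"
    and r: "r = real_of_ereal (min (ereal rstar) (ereal \<eta> * \<zeta>))"
    and \<delta>: "\<delta> = (if ereal rstar \<le> ereal \<eta> * \<zeta> then (sqrt (1 + M) - 1)\<^sup>2 / \<eta>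
             else M * real_of_ereal \<zeta> - \<eta> * (real_of_ereal \<zeta>)\<^sup>2 / (1 - \<eta> * real_of_ereal \<zeta>))"
    and lam: "lam = r * op_norm nrm (mat 1 - Q) /
             (\<eta> * op_norm nrm Q * (c * op_norm nrm (mat 1 - Q) + \<alpha> * \<tau>))"
    and dev: "nrm (vectorize (Sighat - Sig)) < \<delta>"
  shows "\<exists>Khat.
      (\<forall>K. is_arg_min (glasso_objective v lam Sighat) (\<lambda>K. K \<in> Sym_pos) K \<longleftrightarrow> K = Khat) \<and>
      same_patt_mat v Khat Ks \<and>
      nrm (Gam *v vectorize (Khat - Ks)) \<le> 1 / \<eta> * (1 - 1 / sqrt (1 + M))"
proof -
  define f where "f = face_proj v Is"
  define R where "R = moore_penrose Gam11"
  define q where "q = op_norm nrm Q"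
  define B where "B = op_norm nrm (mat 1 - Q)"
  define W where "W = vectorize (Sig - Sighat)"
  define w where "w = W - lam *\<^sub>R vectorize (unlower f)"
  note N = is_normD[OF nrm]
  have symSig: "Sig \<in> Sym" using Sig_pos by (simp add: Sym_pos_def)
  have symSighat: "Sighat \<in> Sym"
    by (simp add: Sighat sample_cov_def Sym_def transpose_def vec_eq_iff mult.commute)
  have Ks_pos: "Ks \<in> Sym_pos" unfolding Ks by (rule Sym_pos_matrix_inv[OF Sig_pos])
  have Ms_sub: "subspace Ms" unfolding Ms by (rule subspace_model_space)
  have Ms_Sym: "Ms \<subseteq> Sym" by (auto simp: Ms model_space_def)
  have Ks_in: "Ks \<in> Ms"
    using Ks_pos by (auto simp: Ms model_space_def Sym_pos_def patt_space_def active_def)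
  have unlower_in: "unlower y \<in> Ms" if "y \<in> Ss" for y
    using that unfolding Ms Ss Is by (rule unlower_in_model_space[OF p])
  have f_in: "f \<in> Ss" by (simp add: f_def Ss face_proj_in)

  interpret proj_matrix "vectorize ` Ms" PM
    by unfold_locales (simp_all add: PM linear_subspace_image[OF linear_vectorize Ms_sub])
  have Gpos: "x \<bullet> (Gam *v x) > 0" if "x \<noteq> 0" for x
    unfolding Gam by (rule kronecker_Sym_pos[OF Sig_pos that])
  have PR: "PM ** R = R" and PGR: "PM ** Gam ** R = PM"
    unfolding R_def Gam11 using moore_penrose_compression[of Gam] Gpos by blast+
  have Qeq: "Q = Gam ** R" by (simp add: Q R_def)
  have R_in: "R *v x \<in> vectorize ` Ms" for x
    by (metis PR P_in matrix_vector_mul_assoc)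

  have q0: "q \<ge> 0" and B0: "B \<ge> 0" by (simp_all add: q_def B_def op_norm_bound(2)[OF nrm])
  have tau_eq: "tau v nrm Is = ereal \<tau>" and \<tau>pos: "\<tau> > 0"
    using tau_pos tau_fin by (cases "tau v nrm Is"; simp add: \<tau>)+
  define a where "a = B * c + \<alpha> * \<tau>"
  have a: "a > 0" unfolding a_def using B0 c(1) \<alpha> \<tau>pos by (intro add_nonneg_pos) auto
  have Meq: "M = \<alpha> * \<tau> / (q * a)" by (simp add: M q_def B_def a_def)
  have lameq: "lam = r * B / (\<eta> * q * a)" by (simp add: lam q_def B_def a_def mult.commute)
  have M0: "M \<ge> 0" using a q0 \<alpha> \<tau>pos by (simp add: Meq)
  have \<delta>0: "\<delta> > 0" using dev N(1)[of "vectorize (Sighat - Sig)"] by linarith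
  note tun = tuning_constants[OF M0 \<eta>(1) \<delta>0 _ rstar r \<delta>, unfolded \<zeta>, OF zeta_pos_or_undefined]
  \<comment> \<open>for \<open>q = 0\<close> the quotient \<open>M\<close> would be 0\<close>
  have q: "q > 0" using tun(1) q0 by (cases "q = 0") (auto simp: Meq)
  define \<rho> where "\<rho> = r\<^sup>2 / (\<eta> * (1 - r))"
  have lam0: "lam \<ge> 0" using tun(2) B0 \<eta>(1) q a by (simp add: lameq)
  \<comment> \<open>\<open>\<lambda>\<close> is the value for which the same bound on the noise suffices for the fixed point (\<open>balP\<close>)
    and for the dual certificate (\<open>balD\<close>)\<close>
  have balP: "q * (r * M / \<eta> + lam * c) = r / \<eta>"
    using q a \<eta>(1) unfolding Meq lameq by (simp add: field_simps) (simp add: a_def algebra_simps)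
  have balD: "B * (r * M / \<eta>) = lam * (\<alpha> * \<tau>)"
    unfolding Meq lameq by (simp add: field_simps)
  have NW: "nrm W < r * M / \<eta> - \<rho>"
  proof -
    have "W = - vectorize (Sighat - Sig)" by (simp add: W_def vectorize_diff)
    then show ?thesis using dev tun(6) by (simp add: N(6) \<rho>_def)
  qed
  have Df: "duplication *v f = vectorize (unlower f)" by (rule duplication_mult[OF p])
  have NDf: "nrm (vectorize (unlower f)) \<le> c"
  proof -
    have "restricted_dual_gauge v Is f \<le> 1"
      unfolding f_def by (rule restricted_dual_gauge_face_proj) (simp add: Is active_nonempty)
    then have "c * restricted_dual_gauge v Is f \<le> c * 1" using c(1) by (rule mult_left_mono)
    then show ?thesis using c(2)[OF f_in] by (simp add: Df)
  qed

  have "nrm w \<le> nrm W + lam * c"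
    using N(7)[of W "lam *\<^sub>R vectorize (unlower f)"] mult_left_mono[OF NDf lam0] lam0
    by (simp add: w_def N(3))
  then have "nrm w + \<rho> < r * M / \<eta> + lam * c" using NW by simp
  then have "q * (nrm w + \<rho>) < r / \<eta>" using q by (simp add: balP[symmetric])
  then have wb: "op_norm nrm (Sig \<otimes>\<^sub>K Sig ** R) * (nrm w + r\<^sup>2 / (\<eta> * (1 - r))) < r / \<eta>"
    by (simp add: q_def Qeq Gam \<rho>_def)
  obtain D where D: "D \<in> Ms" "vectorize D = R *v (w + vectorize (inverse_remainder Sig D))"
    "nrm (Gam *v vectorize D) < r / \<eta>" "nrm (vectorize (inverse_remainder Sig D)) \<le> \<rho>"
    "Ks + D \<in> Sym_pos"
    using restricted_stationary_point_exists[OF Sig_pos Ms_sub Ms_Sym nrm R_in \<eta>(1) _ tun(2,4) wb] \<eta>(2)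
    unfolding \<rho>_def Ks Gam by blast
  define K where "K = Ks + D"
  define g where "g = w + vectorize (inverse_remainder Sig D)"
  have K_in: "K \<in> Ms" using Ks_in D(1) Ms_sub by (simp add: K_def subspace_add)
  have K_pos: "K \<in> Sym_pos" using D(5) by (simp add: K_def)
  have patt: "same_patt_mat v K Ks"
    unfolding Ks
  proof (rule same_patt_mat_below_zeta)
    show "K \<in> model_space v (matrix_inv Sig)" using K_in by (simp add: Ms Ks)
    have "ereal (nrm (Gam *v vectorize D)) < ereal (r / \<eta>)" using D(3) by simp
    also have "\<dots> \<le> zeta v nrm Sig" by (rule tun(5))
    finally show "ereal (nrm (Sig \<otimes>\<^sub>K Sig *v vectorize (K - matrix_inv Sig))) < zeta v nrm Sig"
      by (simp add: K_def Ks Gam)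
  qed

  \<comment> \<open>the residual of the stationarity equation; it will turn out to be \<open>\<lambda> D \<pi>\<close>\<close>
  define E where "E = matrix_inv K - Sighat - lam *\<^sub>R unlower f"
  have symE: "E \<in> Sym"
  proof -
    have "matrix_inv K \<in> Sym" using Sym_pos_matrix_inv[OF K_pos] by (simp add: Sym_pos_def)
    then show ?thesis unfolding E_def
      by (intro subspace_diff[OF subspace_Sym] subspace_scale[OF subspace_Sym] symSighat unlower_Sym)
  qed
  have vecE: "vectorize E = (mat 1 - Q) *v g"
  proof -
    have "matrix_inv K = inverse_remainder Sig D + Sig - Sig ** D ** Sig"
      by (simp add: inverse_remainder_def K_def Ks)
    moreover have "vectorize (Sig ** D ** Sig) = Q *v g"
      using vectorize_mult[of Sig D Sig] symSig
      by (simp add: Qeq g_def D(2)[symmetric] matrix_vector_mul_assoc[symmetric] Gam Sym_def)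
    ultimately show ?thesis
      by (simp add: E_def g_def w_def W_def vectorize_add vectorize_diff vectorize_scaleR
          matrix_vector_mult_diff_rdistrib)
  qed
  have "PM *v vectorize E = 0"
  proof -
    have "PM *v (Q *v g) = PM *v g"
      by (simp add: Qeq matrix_vector_mul_assoc matrix_mul_assoc PGR)
    then show ?thesis
      by (simp add: vecE matrix_vector_mult_diff_rdistrib matrix_vector_mult_diff_distrib)
  qed
  then have orth: "Y \<bullet> E = 0" if "Y \<in> Ms" for Y
    using P_zero_orthogonal[of "vectorize E" "vectorize Y"] that by (simp add: inner_vectorize)
  have "E \<in> Sym_zero"
    by (intro Sym_zero_orthogonal_diagonal symE orth) (simp add: Ms diagonal_in_model_space[OF p])
  define \<epsilon> where "\<epsilon> = vectorize_lower E"
  have E: "unlower \<epsilon> = E" unfolding \<epsilon>_def by (rule unlower_vectorize_lower[OF \<open>E \<in> Sym_zero\<close>])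
  have \<epsilon>_orth: "y \<bullet> \<epsilon> = 0" if "y \<in> Ss" for y
    using orth[OF unlower_in[OF that]] by (simp add: inner_unlower[OF p symE] \<epsilon>_def)
  have NE: "nrm (vectorize E) \<le> B * (nrm W + \<rho>) + lam * ((1 - \<alpha>) * \<tau>)"
  proof -
    let ?RW = "W + vectorize (inverse_remainder Sig D)"
    have "PM *v vectorize (unlower f) = vectorize (unlower f)"
      using unlower_in[OF f_in] by (intro P_fix) blast
    moreover have "Gam21 ** R = Q - PM"
      unfolding Gam21 Qeq
      by (simp add: matrix_mul_assoc[symmetric] PR matrix_diff_rdistrib) (simp add: matrix_mul_assoc PGR)
    ultimately have "(Gam21 ** R) *v vectorize (unlower f) = - ((mat 1 - Q) *v vectorize (unlower f))"
      by (simp add: matrix_vector_mult_diff_rdistrib)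
    then have irr': "nrm ((mat 1 - Q) *v vectorize (unlower f)) \<le> (1 - \<alpha>) * \<tau>"
      using irr by (simp add: f_def[symmetric] Df R_def N(6))
    have "vectorize E = (mat 1 - Q) *v ?RW - lam *\<^sub>R ((mat 1 - Q) *v vectorize (unlower f))"
      by (simp add: vecE g_def w_def algebra_simps)
    then have "nrm (vectorize E)
        \<le> nrm ((mat 1 - Q) *v ?RW) + lam * nrm ((mat 1 - Q) *v vectorize (unlower f))"
      using N(7)[of "(mat 1 - Q) *v ?RW" "lam *\<^sub>R ((mat 1 - Q) *v vectorize (unlower f))"] lam0
      by (simp add: N(3))
    moreover have "nrm ((mat 1 - Q) *v ?RW) \<le> B * (nrm W + \<rho>)"
    proof -
      have "nrm ((mat 1 - Q) *v ?RW) \<le> B * nrm ?RW" unfolding B_def by (rule op_norm_bound(1)[OF nrm])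
      also have "\<dots> \<le> B * (nrm W + \<rho>)"
        using N(4)[of W "vectorize (inverse_remainder Sig D)"] D(4) B0 by (intro mult_left_mono) simp_all
      finally show ?thesis .
    qed
    ultimately show ?thesis using mult_left_mono[OF irr' lam0] by linarith
  qed
  define \<pi> where "\<pi> = (1 / lam) *\<^sub>R \<epsilon>"
  have ND\<pi>: "nrm (duplication *v \<pi>) < \<tau>" and lam\<pi>: "lam *\<^sub>R \<pi> = \<epsilon>"
  proof -
    have D\<epsilon>: "duplication *v \<epsilon> = vectorize E" by (simp add: duplication_mult[OF p] E)
    have "nrm (duplication *v \<pi>) < \<tau> \<and> lam *\<^sub>R \<pi> = \<epsilon>"
    proof (cases "lam = 0")
      case True
      \<comment> \<open>then \<open>Q = 1\<close>, the residual vanishes, and \<open>\<pi> = 0\<close> by the convention \<open>1 / 0 = 0\<close>\<close>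
      then have "B = 0" using tun(2) \<eta>(1) q a by (simp add: lameq)
      then have "nrm (vectorize E) = 0" using NE N(1)[of "vectorize E"] True by simp
      then have "E = 0" by (simp add: N(2) vectorize_eq_0_iff)
      then have "\<epsilon> = 0" by (simp add: \<epsilon>_def vectorize_lower_def vec_eq_iff)
      then show ?thesis using \<tau>pos by (simp add: \<pi>_def N(5))
    next
      case False
      then have lam_pos: "lam > 0" using lam0 by simp
      then have "B > 0" using B0 by (cases "B = 0") (auto simp: lameq)
      then have "B * (nrm W + \<rho>) < B * (r * M / \<eta>)"
        using NW by (intro mult_strict_left_mono) simp_all
      then have "nrm (vectorize E) < lam * \<tau>" using NE balD by (simp add: algebra_simps)
      then show ?thesis
        using lam_pos by (simp add: \<pi>_def matrix_vector_mult_scaleR N(3) D\<epsilon> field_simps)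
    qed
    then show "nrm (duplication *v \<pi>) < \<tau>" "lam *\<^sub>R \<pi> = \<epsilon>" by blast+
  qed
  have \<pi>_orth: "y \<bullet> \<pi> = 0" if "y \<in> Ss" for y using \<epsilon>_orth[OF that] by (simp add: \<pi>_def)
  then have "\<pi> \<in> (patt_space v Is)\<^sup>\<bottom>" by (simp add: orthogonal_comp_def orthogonal_def Ss)
  then have "dual_gauge v (f + \<pi>) \<le> 1"
    unfolding f_def by (rule dual_gauge_below_tau[where N = nrm]) (simp add: tau_eq ND\<pi>)
  then have feas: "(f + \<pi>) \<bullet> x \<le> atomic_norm v x" for x by (rule dual_gauge_le_1D[OF atoms])

  have att: "(f + \<pi>) \<bullet> vectorize_lower K = atomic_norm v (vectorize_lower K)"
  proof -
    obtain i where i: "i \<in> Is" using active_nonempty by (auto simp: Is)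
    have K_S: "vectorize_lower K \<in> Ss" using K_in by (simp add: Ms model_space_def Ss Is)
    have "v i \<bullet> vectorize_lower K = atomic_norm v (vectorize_lower K)"
      using patt i unfolding same_patt_mat_def Is by (rule same_patt_active)
    moreover have "f \<bullet> vectorize_lower K = v i \<bullet> vectorize_lower K"
      using K_S unfolding f_def Ss by (rule face_proj_inner[OF i])
    moreover have "\<pi> \<bullet> vectorize_lower K = 0"
      using \<pi>_orth[OF K_S] by (simp add: inner_commute)
    ultimately show ?thesis by (simp add: inner_add_left)
  qed
  have stat: "matrix_inv K - Sighat = lam *\<^sub>R unlower (f + \<pi>)"
  proof -
    have "unlower (f + \<pi>) = unlower f + unlower \<pi>" "lam *\<^sub>R unlower \<pi> = unlower (lam *\<^sub>R \<pi>)"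
      by (simp_all add: unlower_def vec_eq_iff)
    then show ?thesis using E by (simp add: lam\<pi> E_def scaleR_add_right)
  qed
  have "nrm (Gam *v vectorize (K - Ks)) \<le> 1 / \<eta> * (1 - 1 / sqrt (1 + M))"
  proof -
    have "r / \<eta> \<le> rstar / \<eta>" using tun(3) \<eta>(1) by (simp add: divide_right_mono)
    then show ?thesis using D(3) by (simp add: K_def rstar)
  qed
  then show ?thesis
    using patt glasso_unique_minimizer[OF p K_pos symSighat lam0 feas att stat] by blast
qed

end
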